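(* Let $\ell\ge3$ and $0\le t\le\ell$ be integers, and let $C$ be an oriented cycle obtained by reversing the orientation of $t$ edges of the directed cycle $C_\ell$, such that $\mathcal{C}(P_3,C)\ne0$. (i) If $\mathcal{C}(P_3,C)<0$, and one of the following holds: $\ell$ is odd; or $\ell\equiv0\pmod4$ and $t$ is even; or $\ell\equiv2\pmod4$ and $t$ is odd; then $C$ is locally tournament Sidorenko (LTS). (ii) If $\mathcal{C}(P_3,C)>0$, and one of the following holds: $\ell$ is odd; or $\ell\equiv0\pmod4$ and $t$ is odd; or $\ell\equiv2\pmod4$ and $t$ is even; then $C$ is locally tournament anti-Sidorenko (LTAS). (iii) Otherwise, $C$ is neither LTS nor LTAS.
   Context: $C_\ell$ is the cycle of length $\ell$ with all edges oriented clockwise. $P_3$ is the directed path $\rightarrow\rightarrow$ on 3 vertices. $\mathcal{C}(P_3,C)$ is the signed count of copies of $P_3$ in $C$: the sum, over all pairs of consecutive edges of $C$ (two-edge subpaths), of $+1$ if the two edges point in the same direction around the cycle and $-1$ otherwise. A weighted tournament on $n$ vertices is a function $A:[n]^2\to[0,1]$ with $A(x,y)+A(y,x)=1$ for all $x,y$ (so $A(x,x)=1/2$). For a digraph $D$, $t_D(A)=n^{-v(D)}\sum_{\phi:V(D)\to[n]}\prod_{(x,y)\in E(D)}A(\phi(x),\phi(y))$. Write $A=\frac12J+B$ with $J$ the all-ones matrix and $B$ skew-symmetric, and let $\lambda_{\max}(B)$ be the largest modulus of an eigenvalue of $B$. $D$ is LTS if there is $\varepsilon=\varepsilon(D)>0$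 such that for every $n$ and every weighted tournament $A=\frac12J+B$ on $n$ vertices with $\lambda_{\max}(B)\le\varepsilon n$ one has $t_D(A)\ge2^{-e(D)}$; it is LTAS if there is such an $\varepsilon$ with $t_D(A)\le2^{-e(D)}$ for all such $A$. *)

theory Defs
  imports
    "Graph_Theory.Pair_Digraph"
    "Jordan_Normal_Form.Spectral_Radius"
begin

text \<open>Matrices are indexed from 0, so the vertex set of a weighted tournament on \<open>n\<close>
  vertices is \<open>{0..<n}\<close>.\<close>

definition weighted_tournament :: "nat \<Rightarrow> real mat \<Rightarrow> bool" where
  "weighted_tournament n A \<longleftrightarrow>
     A \<in> carrier_mat n n \<and>
     (\<forall>x<n. \<forall>y<n. 0 \<le> A $$ (x, y) \<and> A $$ (x, y) \<le> 1 \<and> A $$ (x, y) + A $$ (y, x) = 1)"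

definition all_ones_mat :: "nat \<Rightarrow> real mat" where
  "all_ones_mat n = mat n n (\<lambda>_. 1)"

text \<open>The matrix \<open>B\<close> in the decomposition \<open>A = 1/2 J + B\<close>.\<close>

definition skew_part :: "real mat \<Rightarrow> real mat" where
  "skew_part A = A - (1/2) \<cdot>\<^sub>m all_ones_mat (dim_row A)"

text \<open>The spectrum is taken over the complex numbers: a real skew-symmetric matrix has purely
  imaginary eigenvalues.\<close>

definition lambda_max :: "real mat \<Rightarrow> real" where
  "lambda_max B = spectral_radius (map_mat complex_of_real B)"

definition hom_density :: "'a pair_pre_digraph \<Rightarrow> real mat \<Rightarrow> real" where
  "hom_density D A =
     (\<Sum>\<phi> \<in> pverts D \<rightarrow>\<^sub>E {0..<dim_row A}. \<Prod>(x, y) \<in> parcs D. A $$ (\<phi> x, \<phi> y))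
       / real (dim_row A) ^ card (pverts D)"

text \<open>The restriction \<open>n \<ge> 1\<close> below is needed because for \<open>n = 0\<close> neither the density nor the
  spectral radius is meaningful.\<close>

definition LTS :: "'a pair_pre_digraph \<Rightarrow> bool" where
  "LTS D \<longleftrightarrow> (\<exists>\<epsilon>>0. \<forall>n\<ge>1. \<forall>A. weighted_tournament n A \<and>
      lambda_max (skew_part A) \<le> \<epsilon> * real n \<longrightarrow> hom_density D A \<ge> (1/2) ^ card (parcs D))"

definition LTAS :: "'a pair_pre_digraph \<Rightarrow> bool" where
  "LTAS D \<longleftrightarrow> (\<exists>\<epsilon>>0. \<forall>n\<ge>1. \<forall>A. weighted_tournament n A \<and>
      lambda_max (skew_part A) \<le> \<epsilon> * real n \<longrightarrow> hom_density D A \<le> (1/2) ^ card (parcs D))"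

definition directed_cycle :: "nat \<Rightarrow> nat pair_pre_digraph" where
  "directed_cycle l = \<lparr> pverts = {0..<l}, parcs = {(i, Suc i mod l) | i. i < l} \<rparr>"

definition reverse_arcs :: "'a rel \<Rightarrow> 'a pair_pre_digraph \<Rightarrow> 'a pair_pre_digraph" where
  "reverse_arcs S D = \<lparr> pverts = pverts D, parcs = (parcs D - S) \<union> S\<inverse> \<rparr>"

text \<open>For an orientation \<open>C\<close> of the cycle on \<open>{0..<l}\<close> (with \<open>l \<ge> 3\<close>), the edge joining \<open>i\<close> and
  \<open>i + 1\<close> (modulo \<open>l\<close>) points clockwise iff \<open>(i, i + 1)\<close> is an arc. The \<open>l\<close> pairs of consecutive
  edges are indexed by the initial vertex \<open>i\<close> of the subpath \<open>i, i + 1, i + 2\<close>.\<close>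

definition clockwise :: "nat \<Rightarrow> nat pair_pre_digraph \<Rightarrow> nat \<Rightarrow> bool" where
  "clockwise l C i \<longleftrightarrow> (i, Suc i mod l) \<in> parcs C"

definition signed_P3_count :: "nat \<Rightarrow> nat pair_pre_digraph \<Rightarrow> int" where
  "signed_P3_count l C =
     (\<Sum>i<l. if clockwise l C i \<longleftrightarrow> clockwise l C (Suc i mod l) then 1 else - 1)"

end

theory Submission
  imports Defs "HOL-Analysis.L2_Norm"
begin

text \<open>
  Write \<open>E = 2B/n\<close>, let \<open>P\<close> be the averaging operator and let \<open>s\<^sub>i = 1\<close> or \<open>-1\<close> be the orientation
  of the \<open>i\<close>-th edge, so that \<open>2\<^sup>l t\<^sub>C(A)\<close> is the trace of the product of the operators \<open>P + s\<^sub>i E\<close>.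
  Every term of the expanded product that contains \<open>P\<close> is an inner product of the shape
  \<open>\<langle>1, \<dots> 1\<rangle>\<close>. As \<open>E\<close> is skew-symmetric, such a term vanishes if it contains \<open>E\<close> once; if it contains
  exactly two factors \<open>E\<close> and these are adjacent, it is \<open>- s\<^sub>i s\<^sub>i\<^sub>+\<^sub>1 q\<close> with \<open>q = |E1|\<^sup>2\<close>; all the others add up to \<open>O(\<delta> q)\<close>
  if \<open>|Ev| \<le> \<delta>|v|\<close>. Hence \<open>2\<^sup>l t\<^sub>C(A) = 1 - q \<C>(P\<^sub>3, C) + (-1)\<^sup>t tr(E\<^sup>l) + O(\<delta> q)\<close>. The trace of \<open>E\<^sup>l\<close>
  is zero for odd \<open>l\<close> and has the sign \<open>(-1)\<^sup>l\<^sup>/\<^sup>2\<close> for even \<open>l\<close>. If the two main terms have opposite signs, the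
  cyclic triangle (where \<open>q = 0\<close>) and a single arc (where \<open>q\<close> dominates the trace as \<open>l \<ge> 4\<close>) show that
  both signs of \<open>t\<^sub>C(A) - 2\<^sup>-\<^sup>l\<close> occur.
\<close>

section \<open>Skew-symmetric kernels\<close>

locale skew_kernel =
  fixes n :: nat and K :: "nat \<Rightarrow> nat \<Rightarrow> real"
  assumes n_pos: "n > 0"
    and skew: "x < n \<Longrightarrow> y < n \<Longrightarrow> K x y = - K y x"
begin

definition T :: "(nat \<Rightarrow> real) \<Rightarrow> nat \<Rightarrow> real" where
  "T v x = (\<Sum>y<n. K x y * v y)"

text \<open>The division by \<open>n\<close> makes \<open>one\<close> a unit vector, so that mapping
  \<open>v\<close> to the constant \<open>ip one v\<close> is the orthogonal projection P onto the
  constants.\<close>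

definition ip :: "(nat \<Rightarrow> real) \<Rightarrow> (nat \<Rightarrow> real) \<Rightarrow> real" where
  "ip v w = (\<Sum>x<n. v x * w x) / n"

definition nrm :: "(nat \<Rightarrow> real) \<Rightarrow> real" where
  "nrm v = sqrt (ip v v)"

definition one :: "nat \<Rightarrow> real" where
  "one x = 1"

lemma T_add: "T (\<lambda>x. v x + w x) = (\<lambda>x. T v x + T w x)"
  by (simp add: T_def fun_eq_iff sum.distrib algebra_simps)

lemma T_scale: "T (\<lambda>x. c * v x) = (\<lambda>x. c * T v x)"
  by (simp add: T_def fun_eq_iff sum_distrib_left algebra_simps)

lemma T_const: "T (\<lambda>x. c) = (\<lambda>x. c * T one x)"
  by (simp add: T_def one_def fun_eq_iff sum_distrib_left algebra_simps)

lemma ip_commute: "ip v w = ip w v"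
  by (simp add: ip_def mult.commute)

lemma ip_add_right: "ip v (\<lambda>x. w x + z x) = ip v w + ip v z"
  by (simp add: ip_def sum.distrib algebra_simps add_divide_distrib)

lemma ip_scale_right: "ip v (\<lambda>x. c * w x) = c * ip v w"
  by (simp add: ip_def sum_distrib_left algebra_simps)

lemma ip_const_right: "ip v (\<lambda>x. c) = c * ip one v"
  by (simp add: ip_def one_def sum_distrib_left mult.commute)

lemma ip_one_one [simp]: "ip one one = 1"
  using n_pos by (simp add: ip_def one_def)

lemma ip_T: "ip v (T w) = - ip (T v) w"
proof -
  have "(\<Sum>x<n. v x * T w x) = (\<Sum>x<n. \<Sum>y<n. v x * (K x y * w y))"
    by (simp add: T_def sum_distrib_left)
  also have "\<dots> = (\<Sum>y<n. \<Sum>x<n. v x * (K x y * w y))"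
    by (rule sum.swap)
  also have "\<dots> = (\<Sum>y<n. \<Sum>x<n. - (K y x * v x * w y))"
  proof (intro sum.cong refl)
    fix x y assume "y \<in> {..<n}" "x \<in> {..<n}"
    hence "K x y = - K y x" by (intro skew) auto
    thus "v x * (K x y * w y) = - (K y x * v x * w y)" by (simp only:) simp
  qed
  also have "\<dots> = - (\<Sum>y<n. T v y * w y)"
    by (simp add: T_def sum_distrib_right sum_negf)
  finally show ?thesis
    by (simp add: ip_def)
qed

lemma ip_T_self [simp]: "ip v (T v) = 0"
  using ip_T[of v v] by (simp add: ip_commute)

lemma ip_nonneg [simp]: "ip v v \<ge> 0"
  by (simp add: ip_def sum_nonneg)

lemma nrm_nonneg [simp]: "nrm v \<ge> 0"
  by (simp add: nrm_def)

lemma nrm_square: "(nrm v)\<^sup>2 = ip v v"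
  by (simp add: nrm_def)

lemma nrm_L2: "nrm v = L2_set v {..<n} / sqrt n"
  by (simp add: nrm_def ip_def L2_set_def real_sqrt_divide power2_eq_square)

lemma nrm_one [simp]: "nrm one = 1"
  by (simp add: nrm_def)

lemma nrm_scale: "nrm (\<lambda>x. c * v x) = \<bar>c\<bar> * nrm v"
proof -
  have "ip (\<lambda>x. c * v x) (\<lambda>x. c * v x) = c\<^sup>2 * ip v v"
    by (simp add: ip_scale_right ip_commute[of "\<lambda>x. c * v x"] power2_eq_square)
  thus ?thesis by (simp add: nrm_def real_sqrt_mult)
qed

lemma nrm_const: "nrm (\<lambda>x. c) = \<bar>c\<bar>"
  using nrm_scale[of c one] by (simp add: one_def nrm_one[unfolded one_def])

lemma nrm_add: "nrm (\<lambda>x. v x + w x) \<le> nrm v + nrm w"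
  using L2_set_triangle_ineq[of v w "{..<n}"] n_pos
  by (simp add: nrm_L2 divide_right_mono flip: add_divide_distrib)

lemma cauchy_schwarz: "\<bar>ip v w\<bar> \<le> nrm v * nrm w"
proof -
  have "\<bar>\<Sum>x<n. v x * w x\<bar> \<le> (\<Sum>x<n. \<bar>v x\<bar> * \<bar>w x\<bar>)"
    by (rule order_trans[OF sum_abs]) (simp add: abs_mult)
  also have "\<dots> \<le> L2_set v {..<n} * L2_set w {..<n}"
    by (rule L2_set_mult_ineq)
  finally have "\<bar>\<Sum>x<n. v x * w x\<bar> / n \<le> L2_set v {..<n} * L2_set w {..<n} / n"
    by (rule divide_right_mono) simp
  thus ?thesis by (simp add: nrm_L2 ip_def)
qed

lemma coord_le_nrm:
  assumes "x < n"
  shows "\<bar>v x\<bar> \<le> sqrt n * nrm v"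
proof -
  have "L2_set v {..<n} \<ge> \<bar>v x\<bar>"
    using member_le_L2_set[of "{..<n}" x "\<lambda>x. \<bar>v x\<bar>"] assms by (simp add: L2_set_def)
  thus ?thesis using n_pos by (simp add: nrm_L2)
qed

lemma nrm_le_coord:
  assumes "\<And>x. x < n \<Longrightarrow> \<bar>v x\<bar> \<le> c" 
  shows "nrm v \<le> c"
proof -
  have c: "c \<ge> 0" using assms[OF n_pos] by linarith
  have "v x * v x \<le> c\<^sup>2" if "x < n" for x
    using power_mono[OF assms[OF that], of 2] by (simp add: power2_eq_square)
  hence "(\<Sum>x<n. v x * v x) \<le> (\<Sum>x<n. c\<^sup>2)" by (intro sum_mono) auto
  hence "ip v v \<le> c\<^sup>2" using n_pos by (simp add: ip_def field_simps)
  thus ?thesis using c unfolding nrm_def by (metis real_le_lsqrt ip_nonneg)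
qed

text \<open>Skew-symmetry gives |Tw|^2 = -<w, TTw> <= |w| |TTw|. The norms of the iterates are
  therefore log-convex, and the ratio of successive norms never falls below its initial
  value.\<close>

lemma nrm_T_power_mono:
  assumes "nrm (T v) > nrm v" and "nrm v > 0"
  shows "(nrm (T v) / nrm v) ^ k * nrm v \<le> nrm ((T ^^ k) v)"
proof -
  let ?r = "nrm (T v) / nrm v"
  have r: "?r \<ge> 1" using assms by simp
  have step: "(nrm (T w))\<^sup>2 \<le> nrm w * nrm (T (T w))" for w
    using cauchy_schwarz[of w "T (T w)"] ip_T[of w "T w"] by (simp add: nrm_square)
  have "nrm ((T ^^ k) v) > 0 \<and> ?r * nrm ((T ^^ k) v) \<le> nrm ((T ^^ Suc k) v)" for k
  proof (induction k)
    case 0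
    show ?case using assms by simp
  next
    case (Suc k)
    let ?a = "nrm ((T ^^ k) v)" and ?b = "nrm ((T ^^ Suc k) v)" and ?c = "nrm ((T ^^ Suc (Suc k)) v)"
    have a: "?a > 0" and ab: "?r * ?a \<le> ?b" using Suc by auto
    have b: "?b > 0" using a ab r
      by (smt (verit) mult_le_cancel_right1)
    have "?r * ?a * ?b \<le> ?b * ?b" using ab b by (intro mult_right_mono) auto
    also have "\<dots> \<le> ?a * ?c" using step[of "(T ^^ k) v"] by (simp add: power2_eq_square)
    finally have "?a * (?r * ?b) \<le> ?a * ?c" by (simp add: mult_ac)
    hence "?r * ?b \<le> ?c" using a by (simp only: mult_le_cancel_left_pos)
    with b show ?case by blast
  qed
  hence step': "?r * nrm ((T ^^ k) v) \<le> nrm ((T ^^ Suc k) v)" for k by blast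
  show ?thesis
  proof (induction k)
    case (Suc k)
    have "?r ^ Suc k * nrm v = ?r * (?r ^ k * nrm v)" by simp
    also have "\<dots> \<le> ?r * nrm ((T ^^ k) v)" by (rule mult_left_mono[OF Suc]) simp
    also have "\<dots> \<le> nrm ((T ^^ Suc k) v)" by (rule step')
    finally show ?case .
  qed simp
qed

text \<open>A vector stretched by \<open>T\<close> would have geometrically growing iterates. This
  takes the place of diagonalising a skew-symmetric matrix when a spectral radius is turned into a
  norm bound.\<close>

lemma power_bounded_imp_contraction:
  assumes "\<And>k. nrm ((T ^^ k) v) \<le> c"
  shows "nrm (T v) \<le> nrm v"
proof (rule ccontr)
  assume "\<not> nrm (T v) \<le> nrm v"
  hence gt: "nrm (T v) > nrm v" by simp
  have pos: "nrm v > 0"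
  proof (rule ccontr)
    assume "\<not> nrm v > 0"
    hence "nrm v = 0" using nrm_nonneg[of v] by linarith
    hence "v x = 0" if "x < n" for x using coord_le_nrm[OF that, of v] by simp
    hence "T v = (\<lambda>x. 0)" by (simp add: T_def fun_eq_iff)
    thus False using gt \<open>nrm v = 0\<close> by (simp add: nrm_const)
  qed
  have "1 < nrm (T v) / nrm v" using gt pos by simp
  then obtain k where "c / nrm v < (nrm (T v) / nrm v) ^ k"
    using real_arch_pow by blast
  hence "c < (nrm (T v) / nrm v) ^ k * nrm v" using pos by (simp add: field_simps)
  with nrm_T_power_mono[OF gt pos, of k] assms[of k] show False by linarith
qed

section \<open>Traces of powers of a skew-symmetric operator\<close>

definition tr :: "((nat \<Rightarrow> real) \<Rightarrow> nat \<Rightarrow> real) \<Rightarrow> real" where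
  "tr F = (\<Sum>x<n. F (\<lambda>y. if y = x then 1 else 0) x)"

lemma ip_T_power: "ip v ((T ^^ k) w) = (-1) ^ k * ip ((T ^^ k) v) w"
proof (induction k arbitrary: v)
  case (Suc k)
  show ?case using Suc[of "T v"] ip_T[of v "(T ^^ k) w"]
    by (simp add: funpow_swap1)
qed simp

lemma tr_eq_ip: "tr F = n * (\<Sum>x<n. ip (\<lambda>y. if y = x then 1 else 0) (F (\<lambda>y. if y = x then 1 else 0)))"
  using n_pos by (simp add: tr_def ip_def sum_distrib_left if_distrib[of "\<lambda>c. c * _"] cong: if_cong)

text \<open>Moving half of the factors to the other side of the inner product costs (-1)^m and
  leaves the squares |T^m e_x|^2 over the basis vectors e_x.\<close>

lemma tr_T_power_even: "(-1) ^ m * tr (T ^^ (2 * m)) \<ge> 0"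
proof -
  have "tr (T ^^ (2 * m)) = n * (\<Sum>x<n. (-1) ^ m * ip ((T ^^ m) (\<lambda>y. if y = x then 1 else 0)) ((T ^^ m) (\<lambda>y. if y = x then 1 else 0)))"
    by (simp add: tr_eq_ip ip_T_power funpow_add mult_2)
  hence "(-1) ^ m * tr (T ^^ (2 * m)) = n * (\<Sum>x<n. ip ((T ^^ m) (\<lambda>y. if y = x then 1 else 0)) ((T ^^ m) (\<lambda>y. if y = x then 1 else 0)))"
    by (simp add: mult_ac flip: sum_distrib_left)
  thus ?thesis by (simp add: sum_nonneg)
qed

text \<open>Moving m of the 2m + 1 factors to the left leaves one \<open>T\<close> between two
  copies of T^m e_x, and <v, Tv> = 0.\<close>

lemma tr_T_power_odd: "odd l \<Longrightarrow> tr (T ^^ l) = 0"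
proof (elim oddE)
  fix m assume "l = 2 * m + 1"
  hence *: "T ^^ l = T ^^ m \<circ> T \<circ> T ^^ m" by (simp add: fun_eq_iff funpow_add mult_2 funpow_swap1)
  show "tr (T ^^ l) = 0"
    unfolding tr_eq_ip * o_apply by (simp add: ip_T_power)
qed

end

section \<open>Expansion of the trace\<close>

fun adjacent_sum :: "real list \<Rightarrow> real" where
  "adjacent_sum (s # s' # ss) = s * s' + adjacent_sum (s' # ss)"
| "adjacent_sum _ = 0"

lemma adjacent_sum_bound:
  "(\<And>s. s \<in> set ss \<Longrightarrow> \<bar>s\<bar> = 1) \<Longrightarrow> \<bar>adjacent_sum ss\<bar> \<le> length ss"
proof (induction ss rule: adjacent_sum.induct)
  case (1 s s' ss)
  have "\<bar>adjacent_sum (s' # ss)\<bar> \<le> length (s' # ss)" using 1 by simp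
  moreover have "\<bar>s * s'\<bar> = 1" using 1 by (simp add: abs_mult)
  ultimately show ?case by simp
qed auto

text \<open>The extra summand is the pair across the point where the cycle closes. For the edge
  signs of an oriented cycle the value is the signed count of P_3.\<close>

definition cyclic_adjacent_sum :: "real list \<Rightarrow> real" where
  "cyclic_adjacent_sum ss = adjacent_sum ss + last ss * hd ss"

context skew_kernel
begin

text \<open>This is P + s T with P the averaging projection. The head of a list is the outermost
  factor of \<open>XX\<close>; its last entry acts first.\<close>

definition X :: "real \<Rightarrow> (nat \<Rightarrow> real) \<Rightarrow> nat \<Rightarrow> real" where
  "X s v = (\<lambda>x. ip one v + s * T v x)"

abbreviation XX :: "real list \<Rightarrow> (nat \<Rightarrow> real) \<Rightarrow> nat \<Rightarrow> real" where
  "XX ss v \<equiv> foldr X ss v"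

definition d :: "nat \<Rightarrow> real" where
  "d = T one"

text \<open>Since \<open>q\<close> vanishes exactly when all row sums of \<open>K\<close> do, it
  measures the distance from a regular tournament. All errors below are multiples of it.\<close>

definition q :: real where
  "q = ip d d"

lemma q_nonneg: "q \<ge> 0"
  by (simp add: q_def)

lemma nrm_d_square: "nrm d * nrm d = q"
  using nrm_square[of d] by (simp add: q_def power2_eq_square)

lemma ip_one_T: "ip one (T v) = - ip d v"
  by (simp add: ip_T d_def)

lemma ip_one_d [simp]: "ip one d = 0"
  by (simp add: d_def)

text \<open>This and the next lemma peel off the outermost factor: against \<open>one\<close>, the
  operator \<open>T\<close> passes to the left and becomes -\<open>d\<close>; against
  \<open>d\<close>, the averaging part disappears because \<open>d\<close> is orthogonal to
  \<open>one\<close>.\<close>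

lemma ip_one_X: "ip one (X s v) = ip one v - s * ip d v"
  by (simp add: X_def ip_add_right[of _ "\<lambda>_. ip one v"] ip_const_right ip_scale_right ip_one_T)

lemma ip_d_X: "ip d (X s v) = s * ip d (T v)"
  by (simp add: X_def ip_add_right[of _ "\<lambda>_. ip one v"] ip_const_right ip_scale_right)

lemma T_X: "T (X s v) = (\<lambda>x. ip one v * d x + s * T (T v) x)"
  by (simp add: X_def T_add[of "\<lambda>_. ip one v"] T_const T_scale d_def)

lemma X_sum: "X s (\<lambda>x. \<Sum>i\<in>I. c i * f i x) = (\<lambda>x. \<Sum>i\<in>I. c i * X s (f i) x)"
proof (induction I rule: infinite_finite_induct)
  case (insert i I)
  have "X s (\<lambda>x. c i * f i x + (\<Sum>i\<in>I. c i * f i x))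
      = (\<lambda>x. c i * X s (f i) x + X s (\<lambda>x. \<Sum>i\<in>I. c i * f i x) x)"
    by (simp add: X_def T_add T_scale ip_add_right ip_scale_right algebra_simps)
  thus ?case using insert by simp
qed (simp_all add: X_def T_const ip_const_right fun_eq_iff T_def ip_def)

lemma XX_sum: "XX ss (\<lambda>x. \<Sum>i\<in>I. c i * f i x) = (\<lambda>x. \<Sum>i\<in>I. c i * XX ss (f i) x)"
  by (induction ss) (simp_all add: X_sum)

lemma ip_sum_right: "ip v (\<lambda>x. \<Sum>i\<in>I. c i * f i x) = (\<Sum>i\<in>I. c i * ip v (f i))"
  by (simp add: ip_def sum_distrib_left sum_divide_distrib sum.swap[of _ I] mult_ac)

lemma T_power_lin: "(T ^^ k) (\<lambda>x. c + a * v x) = (\<lambda>x. c * (T ^^ k) one x + a * (T ^^ k) v x)"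
proof (induction k)
  case (Suc k)
  show ?case by (simp add: Suc T_add[of "\<lambda>x. c * _ x"] T_scale)
qed (simp add: one_def)

text \<open>Vectors are functions on all naturals, but \<open>T\<close> and \<open>ip\<close> read
  only the entries below \<open>n\<close>. Agreement there already gives \<open>T v = T w\<close> as
  functions.\<close>

lemma restrict_sum: 
  assumes "\<And>x. x < n \<Longrightarrow> v x = w x"
  shows "T v = T w" "ip z v = ip z w"
  using assms by (simp_all add: T_def ip_def fun_eq_iff)

text \<open>Linearity is applied to the expansion of \<open>c\<close> in the standard basis. That
  expansion agrees with \<open>c\<close> only below \<open>n\<close>; for a nonempty word the
  innermost factor ignores the other entries, and for the empty word the inner product does.\<close>

lemma ip_XX_basis:
  "(\<Sum>x<n. c x * ip one (XX ss (\<lambda>y. if y = x then 1 else 0))) = ip one (XX ss c)"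
proof -
  let ?c = "\<lambda>x. \<Sum>i<n. c i * (if x = i then 1 else 0)"
  have eq: "ip one (XX ss ?c) = ip one (XX ss c)"
  proof (cases ss rule: rev_cases)
    case Nil
    show ?thesis unfolding Nil foldr.simps id_apply
      by (rule restrict_sum) (simp add: if_distrib[of "\<lambda>x. _ * x"] cong: if_cong)
  next
    case (snoc ss' s)
    have *: "?c x = c x" if "x < n" for x
      using that by (simp add: if_distrib[of "\<lambda>x. _ * x"] cong: if_cong)
    have "X s ?c = X s c"
      unfolding X_def using restrict_sum[of ?c c, OF *] by simp
    thus ?thesis by (simp add: snoc)
  qed
  thus ?thesis by (simp add: XX_sum ip_sum_right)
qed

text \<open>Telescoping over the position of the first averaging operator in the product: cutting the cycle there turns the trace into an inner product.\<close>

lemma tr_XX_aux: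
  "tr (\<lambda>v x. c * (T ^^ k) (XX ss v) x) =
     (\<Sum>j<length ss. c * (\<Prod>i<j. ss ! i) * ip one (XX (drop (Suc j) ss) ((T ^^ (k + j)) one)))
      + c * prod_list ss * tr (T ^^ (k + length ss))"
proof (induction ss arbitrary: c k)
  case Nil
  show ?case by (simp add: tr_def sum_distrib_left)
next
  case (Cons s ss)
  \<comment> \<open>The outermost factor is split into P and s T. The P part is a rank-one operator
    whose trace is an inner product; the other part lengthens the accumulated power of
    \<open>T\<close>, and \<open>c\<close> absorbs its sign. This is why \<open>c\<close> and
    \<open>k\<close> are general.\<close>
  have "tr (\<lambda>v x. c * (T ^^ k) (XX (s # ss) v) x)
      = tr (\<lambda>v x. c * ip one (XX ss v) * (T ^^ k) one x + (c * s) * (T ^^ Suc k) (XX ss v) x)"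
    by (simp add: X_def T_power_lin funpow_swap1 algebra_simps)
  also have "\<dots> = c * (\<Sum>x<n. (T ^^ k) one x * ip one (XX ss (\<lambda>y. if y = x then 1 else 0)))
      + tr (\<lambda>v x. (c * s) * (T ^^ Suc k) (XX ss v) x)"
    unfolding tr_def sum.distrib sum_distrib_left by (simp add: mult_ac)
  also have "(\<Sum>x<n. (T ^^ k) one x * ip one (XX ss (\<lambda>y. if y = x then 1 else 0)))
      = ip one (XX ss ((T ^^ k) one))"
    by (rule ip_XX_basis)
  also note Cons.IH
  finally show ?case
    by (simp add: sum.lessThan_Suc_shift prod.lessThan_Suc_shift mult_ac del: sum.lessThan_Suc prod.lessThan_Suc funpow.simps)
qed

lemma tr_XX:
  "tr (XX ss) =
     (\<Sum>j<length ss. (\<Prod>i<j. ss ! i) * ip one (XX (drop (Suc j) ss) ((T ^^ j) one)))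
      + prod_list ss * tr (T ^^ length ss)"
  using tr_XX_aux[of 1 0 ss] by simp

end

section \<open>Second-order estimates for contractions\<close>

locale skew_contraction = skew_kernel +
  fixes \<delta> :: real
  assumes \<delta>: "0 \<le> \<delta>" "\<delta> \<le> 1"
    and T_bound: "nrm (T v) \<le> \<delta> * nrm v"
begin

lemma nrm_d_le: "nrm d \<le> \<delta>"
  using T_bound[of one] by (simp add: d_def)

lemma q_le: "q \<le> \<delta>"
proof -
  have "nrm d * nrm d \<le> \<delta> * 1" using nrm_d_le \<delta> by (intro mult_mono) auto
  thus ?thesis by (simp add: nrm_d_square)
qed

lemma T_bound1: "nrm (T v) \<le> nrm v"
  by (rule order_trans[OF T_bound]) (simp add: \<delta> mult_left_le_one_le)

lemma T_power_bound: "nrm ((T ^^ k) v) \<le> \<delta> ^ k * nrm v"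
proof (induction k)
  case (Suc k)
  have "\<delta> * nrm ((T ^^ k) v) \<le> \<delta> * (\<delta> ^ k * nrm v)"
    using Suc \<delta> by (intro mult_left_mono)
  thus ?case using T_bound[of "(T ^^ k) v"] by simp
qed simp

text \<open>The two outer copies of \<open>d\<close> supply \<open>q\<close>, and every
  \<open>T\<close> between them a factor \<open>\<delta>\<close>.\<close>

lemma ip_d_T_power: "\<bar>ip d ((T ^^ k) d)\<bar> \<le> \<delta> ^ k * q"
proof -
  have "\<bar>ip d ((T ^^ k) d)\<bar> \<le> nrm d * (\<delta> ^ k * nrm d)"
    by (rule order_trans[OF cauchy_schwarz]) (simp add: T_power_bound mult_left_mono)
  thus ?thesis by (simp add: mult_ac flip: nrm_d_square)
qed

text \<open>Common properties of the vectors \<open>T\<^sup>k 1\<close>, which are the inputs of the words in \<open>tr_XX\<close>.\<close>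

definition admissible :: "(nat \<Rightarrow> real) \<Rightarrow> bool" where
  "admissible v \<longleftrightarrow> nrm v \<le> 1 \<and> nrm (T v) \<le> nrm d \<and> \<bar>ip d v\<bar> \<le> q \<and>
     \<bar>ip d (T v) - ip one v * q\<bar> \<le> 2 * \<delta> * q"

lemma admissible_one: "admissible one"
  using q_nonneg \<delta> by (simp add: admissible_def ip_commute[of d one] flip: d_def) (simp add: q_def)

lemma T_power_Suc_one: "(T ^^ Suc k) one = (T ^^ k) d"
  by (simp add: d_def funpow_swap1)

lemma power_le_delta: "k \<ge> 1 \<Longrightarrow> \<delta> ^ k \<le> \<delta>"
  using power_decreasing[of 1 k \<delta>] \<delta> by simp

text \<open>Moving one \<open>T\<close> to the left leaves -<d, T^(k-1) d>, of size at most
  \<open>\<delta>\<close>^(k-1) \<open>q\<close>. The exponent 1 is exceptional because it gives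
  exactly -\<open>q\<close>; for exponent 0 the value is 0.\<close>

lemma ip_one_T_power_d: "\<bar>ip one ((T ^^ k) d)\<bar> \<le> q"
  and ip_one_T_power_d': "k \<noteq> 1 \<Longrightarrow> \<bar>ip one ((T ^^ k) d)\<bar> \<le> \<delta> * q"
proof -
  have "\<bar>ip one ((T ^^ k) d)\<bar> \<le> q \<and> (k \<noteq> 1 \<longrightarrow> \<bar>ip one ((T ^^ k) d)\<bar> \<le> \<delta> * q)"
  proof (cases k)
    case 0
    thus ?thesis using q_nonneg \<delta> by simp
  next
    case (Suc j)
    have *: "\<bar>ip one ((T ^^ k) d)\<bar> \<le> \<delta> ^ j * q" using ip_d_T_power[of j] by (simp add: Suc ip_one_T)
    have "\<delta> ^ j * q \<le> 1 * q" using \<delta> q_nonneg by (intro mult_right_mono power_le_one)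
    moreover have "\<delta> ^ j * q \<le> \<delta> * q" if "j \<noteq> 0"
      using that q_nonneg power_le_delta[of j] by (intro mult_right_mono) auto
    ultimately show ?thesis using * Suc by fastforce
  qed
  thus "\<bar>ip one ((T ^^ k) d)\<bar> \<le> q" "k \<noteq> 1 \<Longrightarrow> \<bar>ip one ((T ^^ k) d)\<bar> \<le> \<delta> * q" by auto
qed

text \<open>In the last condition the difference is exactly 0 for \<open>one\<close> itself. For k
  >= 1 both terms are separately at most \<open>\<delta> * q\<close>, whence the factor 2.\<close>

lemma admissible_power: "admissible ((T ^^ k) one)"
proof (cases k)
  case 0
  thus ?thesis using admissible_one by simp
next
  case (Suc j)
  have pj: "\<delta> ^ j \<le> 1" using \<delta> by (intro power_le_one)
  have "nrm ((T ^^ k) one) \<le> 1"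
    using T_power_bound[of k one] power_le_one[of \<delta> k] \<delta> by simp
  moreover have "nrm (T ((T ^^ k) one)) \<le> nrm d"
  proof -
    have "\<delta> ^ k * nrm d \<le> 1 * nrm d" using \<delta> by (intro mult_right_mono power_le_one) auto
    thus ?thesis using T_power_bound[of k d]
      by (simp add: d_def flip: funpow_swap1)
  qed
  moreover have "\<bar>ip d ((T ^^ k) one)\<bar> \<le> q"
    using ip_d_T_power[of j] mult_right_mono[OF pj q_nonneg]
    unfolding Suc T_power_Suc_one by linarith
  moreover have "\<bar>ip d (T ((T ^^ k) one)) - ip one ((T ^^ k) one) * q\<bar> \<le> 2 * \<delta> * q"
  proof -
    have "\<bar>ip d (T ((T ^^ k) one))\<bar> \<le> \<delta> ^ k * q"
      using ip_d_T_power[of k] by (simp add: d_def flip: funpow_swap1)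
    also have "\<dots> \<le> \<delta> * q" using Suc q_nonneg by (intro mult_right_mono power_le_delta) auto
    finally have 1: "\<bar>ip d (T ((T ^^ k) one))\<bar> \<le> \<delta> * q" .
    have "\<bar>ip one ((T ^^ k) one)\<bar> \<le> q"
      using ip_one_T_power_d[of j] unfolding Suc T_power_Suc_one .
    also have "\<dots> \<le> \<delta>" by (rule q_le)
    finally have "\<bar>ip one ((T ^^ k) one) * q\<bar> \<le> \<delta> * q"
      using q_nonneg by (simp add: abs_mult mult_right_mono)
    thus ?thesis using 1 by linarith
  qed
  ultimately show ?thesis unfolding admissible_def by blast
qed

section \<open>Words in the operators P + s T\<close>

context
  fixes v :: "nat \<Rightarrow> real"
  assumes v: "admissible v"
begin

text \<open>P and \<open>T\<close> have norm at most 1, so each factor at most doubles the bound.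
  The second estimate keeps its factor |d| because \<open>T\<close> turns the averaged part into a
  multiple of \<open>d\<close>.\<close>

lemma XX_norm:
  assumes "\<And>s. s \<in> set ss \<Longrightarrow> \<bar>s\<bar> = 1"
  shows "nrm (XX ss v) \<le> 2 ^ length ss \<and> nrm (T (XX ss v)) \<le> 2 ^ length ss * nrm d"
  using assms
proof (induction ss)
  case Nil
  show ?case using v by (simp add: admissible_def)
next
  case (Cons s ss)
  let ?w = "XX ss v"
  have s: "\<bar>s\<bar> = 1" and w: "nrm ?w \<le> 2 ^ length ss" "nrm (T ?w) \<le> 2 ^ length ss * nrm d"
    using Cons by auto
  have ip: "\<bar>ip one ?w\<bar> \<le> 2 ^ length ss" using cauchy_schwarz[of one ?w] w by simp
  have "nrm (X s ?w) \<le> \<bar>ip one ?w\<bar> + nrm (T ?w)"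
    unfolding X_def[of s ?w] using nrm_add[of "\<lambda>_. ip one ?w" "\<lambda>x. s * T ?w x"] s
    by (simp add: nrm_const nrm_scale)
  moreover have "nrm (T ?w) \<le> 2 ^ length ss" using T_bound1[of ?w] w by simp
  moreover have "nrm (T (X s ?w)) \<le> \<bar>ip one ?w\<bar> * nrm d + nrm (T (T ?w))"
    unfolding T_X using nrm_add[of "\<lambda>x. ip one ?w * d x" "\<lambda>x. s * T (T ?w) x"] s
    by (simp add: nrm_scale)
  moreover have "\<bar>ip one ?w\<bar> * nrm d \<le> 2 ^ length ss * nrm d"
    using ip by (rule mult_right_mono) simp
  moreover have "nrm (T (T ?w)) \<le> 2 ^ length ss * nrm d" using T_bound1[of "T ?w"] w by simp
  ultimately show ?case using ip by (simp add: algebra_simps)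
qed

text \<open>One |d| comes from the left end of the inner product and one from the second bound of
  \<open>XX_norm\<close>. Hence each factor of the word moves the component along \<open>one\<close>
  by only O(q).\<close>

lemma XX_second_order:
  assumes "\<And>s. s \<in> set ss \<Longrightarrow> \<bar>s\<bar> = 1"
  shows "\<bar>ip d (XX ss v)\<bar> \<le> 2 ^ length ss * q \<and> \<bar>ip one (XX ss v) - ip one v\<bar> \<le> 2 ^ length ss * q"
  using assms
proof (induction ss)
  case Nil
  show ?case using v q_nonneg by (simp add: admissible_def)
next
  case (Cons s ss)
  let ?w = "XX ss v"
  have s: "\<bar>s\<bar> = 1" and ss: "\<And>s. s \<in> set ss \<Longrightarrow> \<bar>s\<bar> = 1" using Cons by auto
  have "\<bar>ip d (T ?w)\<bar> \<le> nrm d * (2 ^ length ss * nrm d)"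
    by (rule order_trans[OF cauchy_schwarz]) (simp add: XX_norm ss mult_left_mono)
  hence "\<bar>ip d (X s ?w)\<bar> \<le> 2 ^ length ss * q"
    using s by (simp add: ip_d_X abs_mult mult_ac flip: nrm_d_square)
  moreover have "2 ^ length ss * q \<ge> 0" using q_nonneg by simp
  moreover have "\<bar>s * ip d ?w\<bar> \<le> 2 ^ length ss * q" using Cons s by (simp add: abs_mult)
  moreover have "\<bar>ip one ?w - ip one v\<bar> \<le> 2 ^ length ss * q" using Cons by simp
  ultimately show ?case
    by (simp add: ip_one_X)
qed

text \<open>In \<open>T_X\<close> the averaged part contributes <1, w> \<open>q\<close>. Replacing
  <1, w> by <1, v> costs O(q) <= O(\<open>\<delta>\<close>) times \<open>q\<close>, and the
  remaining term contains one more \<open>T\<close>, hence one more \<open>\<delta>\<close>.\<close>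

lemma ip_d_T_XX:
  assumes "\<And>s. s \<in> set ss \<Longrightarrow> \<bar>s\<bar> = 1"
  shows "\<bar>ip d (T (XX ss v)) - ip one v * q\<bar> \<le> 2 ^ Suc (length ss) * \<delta> * q"
proof (cases ss)
  case Nil
  thus ?thesis using v by (simp add: admissible_def)
next
  case (Cons s ss')
  let ?w = "XX ss' v"
  have s: "\<bar>s\<bar> = 1" and ss: "\<And>s. s \<in> set ss' \<Longrightarrow> \<bar>s\<bar> = 1" using Cons assms by auto
  have "ip d (T (XX ss v)) - ip one v * q = (ip one ?w - ip one v) * q + s * ip d (T (T ?w))"
    by (simp add: Cons T_X ip_add_right ip_scale_right q_def) (simp add: algebra_simps)
  moreover have "\<bar>(ip one ?w - ip one v) * q\<bar> \<le> 2 ^ length ss' * (\<delta> * q)"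
  proof -
    have "\<bar>(ip one ?w - ip one v) * q\<bar> \<le> (2 ^ length ss' * q) * q"
      using XX_second_order[OF ss] q_nonneg by (simp add: abs_mult mult_right_mono)
    also have "\<dots> \<le> (2 ^ length ss' * \<delta>) * q"
      using q_le q_nonneg by (intro mult_right_mono mult_left_mono) auto
    finally show ?thesis by (simp add: mult_ac)
  qed
  moreover have "\<bar>s * ip d (T (T ?w))\<bar> \<le> 2 ^ length ss' * (\<delta> * q)"
  proof -
    have "nrm (T (T ?w)) \<le> \<delta> * (2 ^ length ss' * nrm d)"
      by (rule order_trans[OF T_bound]) (use XX_norm[OF ss] \<delta> in \<open>simp add: mult_left_mono\<close>)
    hence "\<bar>ip d (T (T ?w))\<bar> \<le> nrm d * (\<delta> * (2 ^ length ss' * nrm d))"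
      using order_trans[OF cauchy_schwarz] mult_left_mono nrm_nonneg by blast
    thus ?thesis using s by (simp add: abs_mult mult_ac flip: nrm_d_square)
  qed
  moreover have "2 ^ Suc (length ss) * \<delta> * q \<ge> 2 ^ length ss' * (\<delta> * q) + 2 ^ length ss' * (\<delta> * q)"
    using q_nonneg \<delta> by (simp add: Cons)
  ultimately show ?thesis by linarith
qed

text \<open>Peeling off two factors subtracts s s' <d, Tw>, which is s s' \<open>q\<close> <1, v> up
  to the error of \<open>ip_d_T_XX\<close>; so every adjacent pair contributes once. The term with
  \<open>last ss\<close> comes from the innermost factor meeting \<open>v\<close>.\<close>

lemma ip_one_XX:
  assumes "\<And>s. s \<in> set ss \<Longrightarrow> \<bar>s\<bar> = 1"
  shows "\<bar>ip one (XX ss v) - (ip one v * (1 - q * adjacent_sum ss)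
           - (if ss = [] then 0 else last ss * ip d v))\<bar> \<le> 2 ^ length ss * (\<delta> * q)"
  using assms
proof (induction ss rule: adjacent_sum.induct)
  case (1 s s' ss)
  let ?e = "ip d (T (XX ss v)) - ip one v * q"
  have s: "\<bar>s\<bar> = 1" "\<bar>s'\<bar> = 1" and ss: "\<And>s. s \<in> set ss \<Longrightarrow> \<bar>s\<bar> = 1" using 1 by auto
  let ?main = "\<lambda>ss. ip one v * (1 - q * adjacent_sum ss) - (if ss = [] then 0 else last ss * ip d v)"
  have "\<bar>ip one (XX (s' # ss) v) - ?main (s' # ss)\<bar> \<le> 2 ^ length (s' # ss) * (\<delta> * q)"
    using 1 by simp
  moreover have "ip one (XX (s # s' # ss) v) = ip one (XX (s' # ss) v) - s * s' * (ip one v * q + ?e)"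
    by (simp add: ip_one_X[of s] ip_d_X)
  hence "ip one (XX (s # s' # ss) v) - ?main (s # s' # ss)
      = (ip one (XX (s' # ss) v) - ?main (s' # ss)) - s * s' * ?e"
    by (simp add: algebra_simps)
  moreover have "\<bar>s * s' * ?e\<bar> \<le> 2 ^ Suc (length ss) * (\<delta> * q)"
    using ip_d_T_XX[of ss] ss s by (simp add: abs_mult mult.assoc)
  ultimately show ?case by simp
qed (use q_nonneg \<delta> in \<open>simp_all add: ip_one_X\<close>)

end

text \<open>In \<open>tr_XX\<close> the index j counts the factors \<open>T\<close> before the first
  P. Order \<open>q\<close> occurs only for j = 0 (pairs within the rest of the word), j = 1 (the
  pair across the cut) and j = 2 (the first two edges); together these are all cyclic pairs.\<close>

lemma tr_XX_estimate:
  assumes len: "length ss \<ge> 3" and ss: "\<And>s. s \<in> set ss \<Longrightarrow> \<bar>s\<bar> = 1"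
  shows "\<bar>tr (XX ss) - (1 - q * cyclic_adjacent_sum ss + prod_list ss * tr (T ^^ length ss))\<bar>
     \<le> length ss * (2 ^ length ss + length ss + 2) * (\<delta> * q)"
proof -
  obtain s0 s1 r where ss_eq: "ss = s0 # s1 # r" "r \<noteq> []"
    using len by (metis (no_types, opaque_lifting) One_nat_def Suc_1 Suc_le_eq length_0_conv length_Cons list.exhaust not_less_eq numeral_3_eq_3 zero_less_Suc less_Suc_eq_0_disj not_less0)
  define l where "l = length ss"
  define summand where "summand j = (\<Prod>i<j. ss ! i) * ip one (XX (drop (Suc j) ss) ((T ^^ j) one))" for j
  define main where "main j = (if j = 0 then 1 - q * adjacent_sum (s1 # r)
     else if j = 1 then - q * (s0 * last r) else if j = 2 then - q * (s0 * s1) else 0)" for j :: nat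
  have dq: "\<delta> * q \<ge> 0" using q_nonneg \<delta> by simp
  have "\<bar>summand j - main j\<bar> \<le> (2 ^ l + l + 2) * (\<delta> * q)" if "j < l" for j
  proof -
    define w where "w = (T ^^ j) one"
    define rs where "rs = drop (Suc j) ss"
    define a where "a = ip one w * (1 - q * adjacent_sum rs) - (if rs = [] then 0 else last rs * ip d w)"
    have adm: "admissible w" unfolding w_def by (rule admissible_power)
    have rs: "\<bar>s\<bar> = 1" if "s \<in> set rs" for s using that ss by (auto simp: rs_def dest: in_set_dropD)
    have sign_prod: "\<bar>\<Prod>i<j. ss ! i\<bar> = 1" using ss \<open>j < l\<close> by (simp add: abs_prod l_def)
    have last1: "\<bar>last rs\<bar> = 1" if "rs \<noteq> []" using rs that by simp
    have "\<bar>ip one (XX rs w) - a\<bar> \<le> 2 ^ length rs * (\<delta> * q)"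
      unfolding a_def by (rule ip_one_XX[OF adm rs])
    also have "\<dots> \<le> 2 ^ l * (\<delta> * q)" 
      using dq by (intro mult_right_mono power_increasing) (auto simp: rs_def l_def)
    finally have "\<bar>(\<Prod>i<j. ss ! i) * (ip one (XX rs w) - a)\<bar> \<le> 2 ^ l * (\<delta> * q)"
      by (simp add: abs_mult sign_prod)
    hence 1: "\<bar>summand j - (\<Prod>i<j. ss ! i) * a\<bar> \<le> 2 ^ l * (\<delta> * q)"
      by (simp add: summand_def rs_def w_def right_diff_distrib)
    have adj: "\<bar>adjacent_sum rs\<bar> \<le> l"
    proof -
      have "\<bar>adjacent_sum rs\<bar> \<le> length rs" by (rule adjacent_sum_bound[OF rs])
      also have "\<dots> \<le> l" by (simp add: rs_def l_def)
      finally show ?thesis .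
    qed
    have 2: "\<bar>(\<Prod>i<j. ss ! i) * a - main j\<bar> \<le> (l + 2) * (\<delta> * q)"
    proof -
      consider "j = 0" | "j = 1" | "j = 2" | "j \<ge> 3" by linarith
      thus ?thesis
      proof cases
        case 1
        have "a = main j" unfolding a_def w_def rs_def main_def 1 using ss_eq
          by (simp add: ip_commute[of d one])
        thus ?thesis using 1 dq by simp
      next
        case 2
        \<comment> \<open>Here <1, w> = 0, so only the term with \<open>last rs\<close> survives and
          gives the closing pair.\<close>
        have "w = d" by (simp add: w_def 2 d_def)
        moreover have "rs = r" by (simp add: rs_def 2 ss_eq)
        ultimately have "(\<Prod>i<j. ss ! i) * a = main j"
          by (simp add: a_def main_def 2 ss_eq q_def)
        thus ?thesis using dq by simp
      next
        case 3
        have w: "w = T d" by (simp add: w_def 3 d_def numeral_2_eq_2)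
        \<comment> \<open>The term with \<open>last rs\<close> drops out because <d, Td> = 0. The
          remaining correction is quadratic in \<open>q\<close> and is absorbed by
          \<open>q_le\<close>.\<close>
        have a: "a = - q * (1 - q * adjacent_sum rs)"
          by (simp add: a_def w ip_one_T q_def)
        have p: "(\<Prod>i<j. ss ! i) = s0 * s1" by (simp add: 3 ss_eq numeral_2_eq_2)
        have m: "main j = - q * (s0 * s1)" by (simp add: main_def 3)
        have "(\<Prod>i<j. ss ! i) * a - main j = (\<Prod>i<j. ss ! i) * (q * q * adjacent_sum rs)"
          unfolding a m p by (simp add: algebra_simps)
        hence "\<bar>(\<Prod>i<j. ss ! i) * a - main j\<bar> = q * q * \<bar>adjacent_sum rs\<bar>"
          using q_nonneg by (simp only: abs_mult sign_prod)
        also have "\<dots> \<le> \<delta> * q * l" 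
          using q_nonneg q_le adj \<delta> by (intro mult_mono) auto
        also have "\<dots> \<le> (l + 2) * (\<delta> * q)" using dq by (simp add: algebra_simps)
        finally show ?thesis .
      next
        case 4
        define k where "k = j - 1"
        \<comment> \<open>As j >= 3, the exponent avoids the exceptional value 1 of
          \<open>ip_one_T_power_d'\<close>.\<close>
        have k: "j = Suc k" "k \<noteq> 1" "k \<ge> 1" using 4 by (auto simp: k_def)
        have w: "w = (T ^^ k) d" by (simp only: w_def k T_power_Suc_one)
        have "\<bar>ip one w\<bar> \<le> \<delta> * q" unfolding w by (rule ip_one_T_power_d'[OF k(2)])
        moreover have "\<bar>1 - q * adjacent_sum rs\<bar> \<le> l + 1"
        proof -
          have "q * \<bar>adjacent_sum rs\<bar> \<le> 1 * real l"
            using q_nonneg q_le adj \<delta> by (intro mult_mono) auto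
          hence "\<bar>q * adjacent_sum rs\<bar> \<le> l" using q_nonneg by (simp add: abs_mult)
          thus ?thesis by linarith
        qed
        ultimately have A: "\<bar>ip one w * (1 - q * adjacent_sum rs)\<bar> \<le> \<delta> * q * (l + 1)"
          unfolding abs_mult using dq by (intro mult_mono) auto
        have "\<delta> ^ k * q \<le> \<delta> * q" using k q_nonneg by (intro mult_right_mono power_le_delta)
        hence "\<bar>ip d w\<bar> \<le> \<delta> * q" using ip_d_T_power[of k] unfolding w by linarith
        hence B: "\<bar>if rs = [] then 0 else last rs * ip d w\<bar> \<le> \<delta> * q"
          using last1 dq by (auto simp: abs_mult)
        have "\<bar>a\<bar> \<le> \<delta> * q * (l + 1) + \<delta> * q"
          unfolding a_def using A B by linarith
        moreover have "main j = 0" using 4 by (simp add: main_def)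
        ultimately show ?thesis using sign_prod by (simp add: abs_mult algebra_simps)
      qed
    qed
    have "\<bar>summand j - main j\<bar> \<le> 2 ^ l * (\<delta> * q) + (l + 2) * (\<delta> * q)" using 1 2 by linarith
    thus ?thesis by (simp add: algebra_simps)
  qed
  hence "\<bar>\<Sum>j<l. summand j - main j\<bar> \<le> l * ((2 ^ l + l + 2) * (\<delta> * q))"
    using sum_norm_bound[of "{..<l}" "\<lambda>j. summand j - main j"] by simp
  moreover have "(\<Sum>j<l. main j) = 1 - q * cyclic_adjacent_sum ss"
  proof -
    have "(\<Sum>j<l. main j) = (\<Sum>j\<in>{0, 1, 2}. main j)"
      by (rule sum.mono_neutral_right) (use len in \<open>auto simp: l_def main_def\<close>)
    thus ?thesis
      by (simp add: main_def cyclic_adjacent_sum_def ss_eq algebra_simps)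
  qed
  moreover have "tr (XX ss) = (\<Sum>j<l. summand j) + prod_list ss * tr (T ^^ length ss)"
    unfolding tr_XX summand_def l_def ..
  ultimately show ?thesis by (simp add: sum_subtractf l_def algebra_simps)
qed

end

section \<open>From the spectral radius to the operator norm\<close>

text \<open>After division by \<open>r\<close> the spectral radius is below 1, so the matrix powers
  stay bounded, and \<open>power_bounded_imp_contraction\<close> bounds the scaled operator by
  1.\<close>

lemma (in skew_kernel) T_bound_spectral_radius:
  assumes "spectral_radius (mat n n (\<lambda>(x, y). complex_of_real (K x y))) < r" and r: "r > 0"
  shows "nrm (T v) \<le> r * nrm v"
proof -
  define M where "M = mat n n (\<lambda>(x, y). complex_of_real (K x y))"
  define K' where "K' x y = K x y / r" for x y
  define M' where "M' = mat n n (\<lambda>(x, y). complex_of_real (K' x y))"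
  interpret S: skew_kernel n K'
    by unfold_locales (rule n_pos, metis K'_def minus_divide_left skew)
  have M [simp]: "M \<in> carrier_mat n n" and M' [simp]: "M' \<in> carrier_mat n n"
    by (simp_all add: M_def M'_def)
  have MM': "M = complex_of_real r \<cdot>\<^sub>m M'"
    by (rule eq_matI) (use r in \<open>auto simp: M_def M'_def K'_def\<close>)
  \<comment> \<open>A leading eigenvalue of \<open>M'\<close> is carried back to \<open>M\<close>,
    which gives r \<open>spectral_radius M'\<close> <= \<open>spectral_radius M\<close>.\<close>
  obtain \<mu> where \<mu>: "eigenvalue M' \<mu>" "cmod \<mu> = spectral_radius M'"
    using spectral_radius_mem_max(1)[OF M' n_pos] unfolding spectrum_def by auto
  obtain w where w: "w \<in> carrier_vec n" "w \<noteq> 0\<^sub>v n" "M' *\<^sub>v w = \<mu> \<cdot>\<^sub>v w"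
    using \<mu>(1) M' unfolding eigenvalue_def eigenvector_def by auto
  have "M *\<^sub>v w = complex_of_real r \<cdot>\<^sub>v (M' *\<^sub>v w)"
    unfolding MM' using w(1) carrier_matD[OF M'] by (intro eq_vecI) auto
  hence "M *\<^sub>v w = (r * \<mu>) \<cdot>\<^sub>v w"
    by (simp add: w smult_smult_assoc)
  hence "r * \<mu> \<in> spectrum M"
    using w carrier_matD(1)[OF M] unfolding spectrum_def eigenvalue_def eigenvector_def by auto
  hence "cmod (r * \<mu>) \<le> spectral_radius M"
    by (intro spectral_radius_mem_max(2)[OF M n_pos]) blast
  hence "r * spectral_radius M' \<le> spectral_radius M"
    using \<mu>(2) r by (simp add: norm_mult)
  hence "r * spectral_radius M' < r * 1" using assms(1) unfolding M_def by linarith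
  hence "spectral_radius M' < 1" using r by (simp only: mult_less_cancel_left_pos)
  \<comment> \<open>The strict inequality makes the powers bounded whatever the Jordan blocks
    are.\<close>
  then obtain c where c: "\<And>k. norm_bound (M' ^\<^sub>m k) c"
    using spectral_radius_jnf_norm_bound_less_1_upper_triangular[OF M'] by blast
  have pow: "complex_of_real ((S.T ^^ k) v x) = (\<Sum>y<n. (M' ^\<^sub>m k) $$ (x, y) * v y)"
    if "x < n" for k v x
    using that
  proof (induction k arbitrary: v)
    case 0
    have "(\<Sum>y<n. (1\<^sub>m n :: complex mat) $$ (x, y) * v y) = (\<Sum>y<n. if x = y then complex_of_real (v y) else 0)"
      using 0 by (intro sum.cong) auto
    thus ?case using 0 carrier_matD(1)[OF M'] by simp
  next
    case (Suc k)
    have "complex_of_real ((S.T ^^ Suc k) v x) = (\<Sum>y<n. (M' ^\<^sub>m k) $$ (x, y) * S.T v y)"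
      using Suc by (simp add: funpow_swap1)
    also have "\<dots> = (\<Sum>y<n. \<Sum>z<n. (M' ^\<^sub>m k) $$ (x, y) * (M' $$ (y, z) * v z))"
      by (simp add: S.T_def sum_distrib_left M'_def)
    also have "\<dots> = (\<Sum>z<n. \<Sum>y<n. (M' ^\<^sub>m k) $$ (x, y) * (M' $$ (y, z) * v z))"
      by (rule sum.swap)
    also have "\<dots> = (\<Sum>z<n. (M' ^\<^sub>m Suc k) $$ (x, z) * v z)"
    proof (rule sum.cong)
      fix z assume "z \<in> {..<n}"
      hence "(M' ^\<^sub>m Suc k) $$ (x, z) = (\<Sum>y<n. (M' ^\<^sub>m k) $$ (x, y) * M' $$ (y, z))"
        using Suc.prems carrier_matD[OF M'] carrier_matD[OF pow_carrier_mat[OF M', of k]]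
        by (simp add: scalar_prod_def lessThan_atLeast0)
      thus "(\<Sum>y<n. (M' ^\<^sub>m k) $$ (x, y) * (M' $$ (y, z) * v z)) = (M' ^\<^sub>m Suc k) $$ (x, z) * v z"
        by (simp add: sum_distrib_right mult.assoc)
    qed simp
    finally show ?case .
  qed
  have "S.nrm ((S.T ^^ k) v) \<le> (\<Sum>y<n. c * \<bar>v y\<bar>)" for k
  proof (rule S.nrm_le_coord)
    fix x assume x: "x < n"
    have "\<bar>(S.T ^^ k) v x\<bar> = cmod (\<Sum>y<n. (M' ^\<^sub>m k) $$ (x, y) * v y)"
      by (simp flip: pow[OF x] add: norm_of_real)
    also have "\<dots> \<le> (\<Sum>y<n. c * \<bar>v y\<bar>)"
    proof (rule sum_norm_le)
      fix y assume "y \<in> {..<n}"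
      hence "y < n" by simp
      hence "cmod ((M' ^\<^sub>m k) $$ (x, y)) \<le> c"
        using c[of k] x carrier_matD[OF pow_carrier_mat[OF M', of k]] unfolding norm_bound_def by metis
      thus "cmod ((M' ^\<^sub>m k) $$ (x, y) * v y) \<le> c * \<bar>v y\<bar>"
        by (simp add: norm_mult mult_right_mono)
    qed
    finally show "\<bar>(S.T ^^ k) v x\<bar> \<le> (\<Sum>y<n. c * \<bar>v y\<bar>)" .
  qed
  hence "S.nrm (S.T v) \<le> S.nrm v" by (rule S.power_bounded_imp_contraction)
  moreover have "S.T v = (\<lambda>x. (1 / r) * T v x)"
    by (simp add: fun_eq_iff S.T_def T_def K'_def sum_divide_distrib)
  ultimately have "\<bar>1 / r\<bar> * nrm (T v) \<le> nrm v" using nrm_scale[of "1 / r" "T v"] by simp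
  thus ?thesis using r by (simp add: field_simps)
qed

section \<open>Closed walks\<close>

lemma sum_PiE_insert:
  assumes "a \<notin> A"
  shows "(\<Sum>\<phi>\<in>insert a A \<rightarrow>\<^sub>E B. F \<phi>) = (\<Sum>z\<in>B. \<Sum>\<phi>\<in>A \<rightarrow>\<^sub>E B. F (\<phi>(a := z)))"
proof -
  have "(\<Sum>\<phi>\<in>insert a A \<rightarrow>\<^sub>E B. F \<phi>) = (\<Sum>(z, \<phi>)\<in>B \<times> (A \<rightarrow>\<^sub>E B). F (\<phi>(a := z)))"
    using inj_combinator[of a A "\<lambda>_. B"] assms
    by (simp add: PiE_insert_eq sum.reindex case_prod_unfold o_def)
  thus ?thesis by (simp add: sum.cartesian_product)
qed

text \<open>The function \<open>g\<close> couples the two ends so that the walk can be closed later.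
  The induction removes the last vertex and absorbs its edge into \<open>g\<close>, which must
  therefore be arbitrary.\<close>

lemma path_sum:
  fixes M :: "nat \<Rightarrow> nat \<Rightarrow> nat \<Rightarrow> real"
  shows "(\<Sum>\<phi>\<in>{0..<Suc k} \<rightarrow>\<^sub>E {0..<n}. (\<Prod>i<k. M i (\<phi> i) (\<phi> (Suc i))) * g (\<phi> 0) (\<phi> k)) =
    (\<Sum>x<n. foldr (\<lambda>i v x. \<Sum>y<n. M i x y * v y) [0..<k] (g x) x)"
proof (induction k arbitrary: g)
  case 0
  have "{0..<Suc 0} = insert 0 {}" by auto
  thus ?case by (simp add: sum_PiE_insert lessThan_atLeast0)
next
  case (Suc k)
  let ?P = "{0..<Suc k} \<rightarrow>\<^sub>E {0..<n}"
  let ?f = "\<lambda>\<phi>. (\<Prod>i<Suc k. M i (\<phi> i) (\<phi> (Suc i))) * g (\<phi> 0) (\<phi> (Suc k))"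
  have upd: "?f (\<phi>(Suc k := z)) = (\<Prod>i<k. M i (\<phi> i) (\<phi> (Suc i))) * (M k (\<phi> k) z * g (\<phi> 0) z)" for \<phi> z
  proof -
    have "(\<Prod>i<k. M i ((\<phi>(Suc k := z)) i) ((\<phi>(Suc k := z)) (Suc i))) = (\<Prod>i<k. M i (\<phi> i) (\<phi> (Suc i)))"
      by (intro prod.cong) auto
    thus ?thesis by simp
  qed
  have "{0..<Suc (Suc k)} = insert (Suc k) {0..<Suc k}" by auto
  hence "(\<Sum>\<phi>\<in>{0..<Suc (Suc k)} \<rightarrow>\<^sub>E {0..<n}. ?f \<phi>)
      = (\<Sum>z\<in>{0..<n}. \<Sum>\<phi>\<in>?P. (\<Prod>i<k. M i (\<phi> i) (\<phi> (Suc i))) * (M k (\<phi> k) z * g (\<phi> 0) z))"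
    by (simp only: sum_PiE_insert[of "Suc k" "{0..<Suc k}", simplified] upd)
  also have "\<dots> = (\<Sum>\<phi>\<in>?P. \<Sum>z\<in>{0..<n}. (\<Prod>i<k. M i (\<phi> i) (\<phi> (Suc i))) * (M k (\<phi> k) z * g (\<phi> 0) z))"
    by (rule sum.swap)
  also have "\<dots> = (\<Sum>\<phi>\<in>?P. (\<Prod>i<k. M i (\<phi> i) (\<phi> (Suc i))) * (\<Sum>z\<in>{0..<n}. M k (\<phi> k) z * g (\<phi> 0) z))"
    by (simp only: sum_distrib_left)
  also note Suc.IH[of "\<lambda>x y. \<Sum>z\<in>{0..<n}. M k y z * g x z"]
  finally show ?case by (simp add: lessThan_atLeast0)
qed

text \<open>The closing edge back to vertex 0 plays the part of \<open>g\<close> in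
  \<open>path_sum\<close>. The right-hand side is the trace of the product of the kernels.\<close>

lemma closed_walk_sum:
  fixes M :: "nat \<Rightarrow> nat \<Rightarrow> nat \<Rightarrow> real"
  assumes "l > 0"
  shows "(\<Sum>\<phi>\<in>{0..<l} \<rightarrow>\<^sub>E {0..<n}. \<Prod>i<l. M i (\<phi> i) (\<phi> (Suc i mod l))) =
    (\<Sum>x<n. foldr (\<lambda>i v x. \<Sum>y<n. M i x y * v y) [0..<l] (\<lambda>y. if y = x then 1 else 0) x)"
proof -
  obtain k where l: "l = Suc k" using assms by (cases l) auto
  have "(\<Prod>i<l. M i (\<phi> i) (\<phi> (Suc i mod l))) = (\<Prod>i<k. M i (\<phi> i) (\<phi> (Suc i))) * M k (\<phi> k) (\<phi> 0)" for \<phi>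
    by (simp add: l)
  moreover have "(\<lambda>y. M k y x) = (\<lambda>x'. \<Sum>y<n. M k x' y * (if y = x then 1 else 0))" if "x < n" for x
    using that by (simp add: if_distrib[of "\<lambda>x. _ * x"] cong: if_cong)
  ultimately show ?thesis
    using path_sum[where k = k and n = n and M = M and g = "\<lambda>x y. M k y x"] by (simp add: l)
qed

section \<open>Oriented cycles\<close>

lemma adjacent_sum_upt: "adjacent_sum (map f [a..<a + Suc k]) = (\<Sum>i<k. f (a + i) * f (a + Suc i))"
proof (induction k arbitrary: a)
  case (Suc k)
  have "[a..<a + Suc (Suc k)] = a # [Suc a..<Suc a + Suc k]" "[Suc a..<Suc a + Suc k] = Suc a # [Suc (Suc a)..<Suc a + Suc k]"
    by (simp_all add: upt_conv_Cons del: upt_Suc)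
  thus ?case using Suc[of "Suc a"]
    by (simp add: sum.lessThan_Suc_shift del: upt_Suc sum.lessThan_Suc)
qed simp

lemma cyclic_adjacent_sum_upt:
  assumes "l > 0"
  shows "cyclic_adjacent_sum (map f [0..<l]) = (\<Sum>i<l. f i * f (Suc i mod l))"
proof -
  obtain k where l: "l = Suc k" using assms by (cases l) auto
  have "hd (map f [0..<l]) = f 0" using hd_map[of "[0..<l]" f] by (simp add: l del: upt_Suc)
  moreover have "(\<Sum>i<k. f i * f (Suc i mod l)) = (\<Sum>i<k. f i * f (Suc i))"
    by (intro sum.cong) (auto simp: l)
  ultimately show ?thesis using adjacent_sum_upt[of f 0 k]
    by (simp add: cyclic_adjacent_sum_def l)
qed

locale oriented_cycle =
  fixes l :: nat and S :: "nat rel" and C :: "nat pair_pre_digraph"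
  assumes l: "3 \<le> l"
    and S: "S \<subseteq> parcs (directed_cycle l)"
    and C: "C = reverse_arcs S (directed_cycle l)"
begin

definition edge_sign :: "nat \<Rightarrow> real" where
  "edge_sign i = (if (i, Suc i mod l) \<in> S then -1 else 1)"

abbreviation signs :: "real list" where
  "signs \<equiv> map edge_sign [0..<l]"

abbreviation arc :: "nat \<Rightarrow> nat \<times> nat" where
  "arc i \<equiv> (if (i, Suc i mod l) \<in> S then (Suc i mod l, i) else (i, Suc i mod l))"

text \<open>This is where l >= 3 matters: a reversed edge never coincides with another edge of the
  cycle, so \<open>C\<close> keeps \<open>l\<close> arcs and its orientations can be read
  off.\<close>

lemma no_digon: "i < l \<Longrightarrow> j < l \<Longrightarrow> i = Suc j mod l \<Longrightarrow> j = Suc i mod l \<Longrightarrow> False"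
proof -
  have *: "Suc k mod l = (if Suc k = l then 0 else Suc k)" if "k < l" for k
    using that by (simp add: mod_Suc)
  assume "i < l" "j < l" "i = Suc j mod l" "j = Suc i mod l"
  hence "(Suc j = l \<and> i = 0) \<or> i = Suc j" "(Suc i = l \<and> j = 0) \<or> j = Suc i"
    using * by metis+
  thus False using l by arith
qed

lemma no_digon': "i < l \<Longrightarrow> Suc (Suc i mod l) mod l \<noteq> i"
  using no_digon[of i "Suc i mod l"] by auto

lemma parcs_C: "parcs C = arc ` {..<l}"
proof -
  have "S \<subseteq> {(i, Suc i mod l) |i. i < l}" using S by (simp add: directed_cycle_def)
  thus ?thesis unfolding C reverse_arcs_def directed_cycle_def by (fastforce simp: image_iff split: if_splits)
qed

lemma inj_arc: "inj_on arc {..<l}"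
  by (rule inj_onI) (auto simp: no_digon' split: if_splits dest: no_digon')

lemma pverts_C: "pverts C = {0..<l}"
  by (simp add: C reverse_arcs_def directed_cycle_def)

lemma card_parcs: "card (parcs C) = l"
  using card_image[OF inj_arc] by (simp only: parcs_C card_lessThan)

lemma clockwise_iff: "i < l \<Longrightarrow> clockwise l C i \<longleftrightarrow> edge_sign i = 1"
proof -
  assume i: "i < l"
  have "(i, Suc i mod l) \<noteq> arc i" if "(i, Suc i mod l) \<in> S"
    using that no_digon'[OF i] by auto
  moreover have "(i, Suc i mod l) \<noteq> arc j" if "j < l" "j \<noteq> i" for j
    using that no_digon'[of j] by auto
  ultimately have "(i, Suc i mod l) \<in> arc ` {..<l} \<longleftrightarrow> (i, Suc i mod l) \<notin> S"
    using i no_digon'[OF i] no_digon'[OF i, symmetric] by (auto simp: image_iff split: if_splits)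
  thus "clockwise l C i \<longleftrightarrow> edge_sign i = 1"
    unfolding clockwise_def parcs_C edge_sign_def by simp
qed

lemma signed_P3_count: "real_of_int (signed_P3_count l C) = cyclic_adjacent_sum signs"
proof -
  have "real_of_int (signed_P3_count l C) = (\<Sum>i<l. edge_sign i * edge_sign (Suc i mod l))"
    unfolding signed_P3_count_def of_int_sum
  proof (intro sum.cong refl)
    fix i assume "i \<in> {..<l}"
    hence "i < l" "Suc i mod l < l" by auto
    thus "real_of_int (if clockwise l C i = clockwise l C (Suc i mod l) then 1 else - 1) = edge_sign i * edge_sign (Suc i mod l)"
      unfolding clockwise_iff[OF \<open>i < l\<close>] clockwise_iff[OF \<open>Suc i mod l < l\<close>] by (auto simp: edge_sign_def)
  qed
  thus ?thesis using l by (simp add: cyclic_adjacent_sum_upt)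
qed

lemma prod_signs: "prod_list signs = (-1) ^ card S"
proof -
  have "prod_list signs = (\<Prod>i<l. edge_sign i)"
    by (simp add: prod.list_conv_set_nth lessThan_atLeast0)
  also have "\<dots> = (\<Prod>i\<in>{i\<in>{..<l}. (i, Suc i mod l) \<in> S}. - 1)"
    unfolding edge_sign_def by (subst prod.inter_filter) auto
  also have "\<dots> = (-1) ^ card {i\<in>{..<l}. (i, Suc i mod l) \<in> S}" by simp
  also have "card {i\<in>{..<l}. (i, Suc i mod l) \<in> S} = card S"
  proof (rule bij_betw_same_card[of "\<lambda>i. (i, Suc i mod l)"])
    show "bij_betw (\<lambda>i. (i, Suc i mod l)) {i\<in>{..<l}. (i, Suc i mod l) \<in> S} S"
      using S by (auto simp: bij_betw_def inj_on_def directed_cycle_def)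
  qed
  finally show ?thesis .
qed

end

section \<open>The density of an oriented cycle\<close>

text \<open>The scaling is such that n/2 times an entry of P + s E is 1/2 + s B, the weight of an
  edge traversed along or against its orientation.\<close>

definition scaled_skew :: "nat \<Rightarrow> real mat \<Rightarrow> nat \<Rightarrow> nat \<Rightarrow> real" where
  "scaled_skew n A x y = 2 / n * (A $$ (x, y) - 1 / 2)"

lemma skew_kernel_scaled_skew:
  assumes "weighted_tournament n A" "n \<ge> 1"
  shows "skew_kernel n (scaled_skew n A)"
proof
  fix x y assume "x < n" "y < n"
  hence "A $$ (x, y) - 1 / 2 = - (A $$ (y, x) - 1 / 2)"
    using assms unfolding weighted_tournament_def by fastforce
  thus "scaled_skew n A x y = - scaled_skew n A y x"
    unfolding scaled_skew_def by (metis mult_minus_right)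
qed (use assms in simp)

lemma map_skew_part:
  assumes "weighted_tournament n A"
  shows "map_mat complex_of_real (skew_part A) = mat n n (\<lambda>(x, y). complex_of_real (A $$ (x, y) - 1 / 2))"
  using assms by (intro eq_matI) (auto simp: weighted_tournament_def skew_part_def all_ones_mat_def)

text \<open>\<open>T_bound_spectral_radius\<close> asks for a strict bound, so
  \<open>\<epsilon> * n\<close> is enlarged to twice its value; the scaling by 2/n then gives
  \<open>4 * \<epsilon>\<close>.\<close>

lemma skew_contraction_scaled_skew:
  fixes \<epsilon> :: real
  assumes A: "weighted_tournament n A" and n: "n \<ge> 1"
    and lam: "lambda_max (skew_part A) \<le> \<epsilon> * n" and \<epsilon>: "\<epsilon> > 0" "4 * \<epsilon> \<le> 1"
  shows "skew_contraction n (scaled_skew n A) (4 * \<epsilon>)"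
proof -
  interpret K: skew_kernel n "scaled_skew n A" by (rule skew_kernel_scaled_skew[OF A n])
  define B where "B x y = A $$ (x, y) - 1 / 2" for x y
  have K_eq: "scaled_skew n A = (\<lambda>x y. 2 / n * B x y)" by (simp add: fun_eq_iff scaled_skew_def B_def)
  interpret B: skew_kernel n B
  proof
    fix x y assume "x < n" "y < n"
    thus "B x y = - B y x" using A unfolding weighted_tournament_def B_def by fastforce
  qed (use n in simp)
  have "\<epsilon> * n < 2 * \<epsilon> * n" using \<epsilon> n by simp
  hence sr: "spectral_radius (mat n n (\<lambda>(x, y). complex_of_real (B x y))) < 2 * \<epsilon> * n"
    using lam unfolding lambda_max_def map_skew_part[OF A] B_def by linarith
  have B_bound: "B.nrm (B.T v) \<le> 2 * \<epsilon> * n * B.nrm v" for v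
    by (rule B.T_bound_spectral_radius[OF sr]) (use \<epsilon> n in simp)
  have "K.T v = (\<lambda>x. 2 / n * B.T v x)" for v
    by (rule ext) (simp only: K.T_def B.T_def, simp add: K_eq sum_distrib_left mult.assoc)
  hence "K.nrm (K.T v) = 2 / n * B.nrm (B.T v)" for v
    using K.nrm_scale[of "2 / n" "B.T v"] by simp
  moreover have "2 / n * B.nrm (B.T v) \<le> 4 * \<epsilon> * B.nrm v" for v
    using mult_left_mono[OF B_bound[of v], of "2 / n"] n by (simp add: field_simps)
  ultimately have "K.nrm (K.T v) \<le> 4 * \<epsilon> * K.nrm v" for v by simp
  thus ?thesis using \<epsilon> by unfold_locales auto
qed

text \<open>The eigenvector equation is read at a coordinate of largest modulus.\<close>

lemma lambda_max_le:
  assumes A: "weighted_tournament n A" and n: "n \<ge> 1"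
    and e: "\<And>x y. x < n \<Longrightarrow> y < n \<Longrightarrow> \<bar>A $$ (x, y) - 1 / 2\<bar> \<le> e"
  shows "lambda_max (skew_part A) \<le> e * n"
proof -
  define M where "M = map_mat complex_of_real (skew_part A)"
  have M_eq: "M = mat n n (\<lambda>(x, y). complex_of_real (A $$ (x, y) - 1 / 2))"
    unfolding M_def by (rule map_skew_part[OF A])
  hence M: "M \<in> carrier_mat n n" by simp
  obtain \<mu> where \<mu>: "eigenvalue M \<mu>" "cmod \<mu> = spectral_radius M"
    using spectral_radius_mem_max(1)[OF M] n unfolding spectrum_def by auto
  obtain w where w: "w \<in> carrier_vec n" "w \<noteq> 0\<^sub>v n" "M *\<^sub>v w = \<mu> \<cdot>\<^sub>v w"
    using \<mu>(1) carrier_matD(1)[OF M] unfolding eigenvalue_def eigenvector_def by auto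
  define m where "m = Max ((\<lambda>x. cmod (w $ x)) ` {..<n})"
  have le_m: "cmod (w $ y) \<le> m" if "y < n" for y
    unfolding m_def using that by (intro Max_ge) auto
  have "m \<in> (\<lambda>x. cmod (w $ x)) ` {..<n}"
    unfolding m_def using n by (intro Max_in) (auto simp: lessThan_empty_iff)
  then obtain x where x: "x < n" "m = cmod (w $ x)" by auto
  have "m > 0"
  proof (rule ccontr)
    assume "\<not> m > 0"
    hence "w $ y = 0" if "y < n" for y using le_m[OF that] by (metis norm_le_zero_iff order_trans not_less)
    hence "w = 0\<^sub>v n" using w(1) by (intro eq_vecI) auto
    thus False using w(2) by blast
  qed
  have "cmod \<mu> * m = cmod ((M *\<^sub>v w) $ x)" using x w by (simp add: norm_mult)
  also have "(M *\<^sub>v w) $ x = (\<Sum>y<n. complex_of_real (A $$ (x, y) - 1 / 2) * w $ y)"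
    using x w(1) by (simp add: M_eq scalar_prod_def lessThan_atLeast0)
  also have "cmod \<dots> \<le> (\<Sum>y<n. e * m)"
  proof (rule sum_norm_le)
    fix y assume "y \<in> {..<n}"
    hence y: "y < n" by simp
    show "cmod (complex_of_real (A $$ (x, y) - 1 / 2) * w $ y) \<le> e * m"
      unfolding norm_mult norm_of_real
      using e[OF x(1) y] le_m[OF y] by (intro mult_mono) auto
  qed
  also have "\<dots> = (e * n) * m" by simp
  finally have "cmod \<mu> \<le> e * n" using \<open>m > 0\<close> by (simp only: mult_le_cancel_right_pos)
  thus ?thesis using \<mu>(2) by (simp add: lambda_max_def M_def)
qed

context oriented_cycle
begin

text \<open>A reversed edge reads A(y,x) = 1 - A(x,y), which flips the sign of the deviation from
  1/2. Every edge is then n/2 times an entry of P + s E, and (n/2)^l cancels against n^l up to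
  2^(-l).\<close>

lemma hom_density_eq:
  assumes A: "weighted_tournament n A" and n: "n \<ge> 1"
  shows "hom_density C A = (1 / 2) ^ l * skew_kernel.tr n (foldr (skew_kernel.X n (scaled_skew n A)) signs)"
proof -
  interpret K: skew_kernel n "scaled_skew n A" by (rule skew_kernel_scaled_skew[OF A n])
  define M where "M i x y = 1 / n + edge_sign i * scaled_skew n A x y" for i x y
  have dim: "dim_row A = n" using A by (auto simp: weighted_tournament_def)
  have swap: "A $$ (y, x) = 1 - A $$ (x, y)" if "x < n" "y < n" for x y
    using A that by (smt (verit) weighted_tournament_def)
  have scale: "n / 2 * (1 / n + s * (2 / n * (a - 1 / 2))) = 1 / 2 + s * (a - 1 / 2)" for s a :: real
    using n by (simp add: field_simps)
  have "(\<Prod>(x, y)\<in>parcs C. A $$ (\<phi> x, \<phi> y)) = (n / 2) ^ l * (\<Prod>i<l. M i (\<phi> i) (\<phi> (Suc i mod l)))"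
    if \<phi>: "\<phi> \<in> {0..<l} \<rightarrow>\<^sub>E {0..<n}" for \<phi>
  proof -
    have "(\<Prod>(x, y)\<in>parcs C. A $$ (\<phi> x, \<phi> y)) = (\<Prod>i<l. case arc i of (x, y) \<Rightarrow> A $$ (\<phi> x, \<phi> y))"
      unfolding parcs_C by (simp only: prod.reindex[OF inj_arc] o_def)
    also have "\<dots> = (\<Prod>i<l. n / 2 * M i (\<phi> i) (\<phi> (Suc i mod l)))"
    proof (intro prod.cong refl)
      fix i assume "i \<in> {..<l}"
      hence "\<phi> i < n" "\<phi> (Suc i mod l) < n" using \<phi> by (auto simp: PiE_iff)
      thus "(case arc i of (x, y) \<Rightarrow> A $$ (\<phi> x, \<phi> y)) = n / 2 * M i (\<phi> i) (\<phi> (Suc i mod l))"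
        unfolding M_def scaled_skew_def scale
        using swap[of "\<phi> i" "\<phi> (Suc i mod l)"] by (auto simp: edge_sign_def)
    qed
    finally show ?thesis by (simp only: prod.distrib prod_constant card_lessThan)
  qed
  hence "hom_density C A = (\<Sum>\<phi>\<in>{0..<l} \<rightarrow>\<^sub>E {0..<n}. (n / 2) ^ l * (\<Prod>i<l. M i (\<phi> i) (\<phi> (Suc i mod l)))) / n ^ l"
    unfolding hom_density_def pverts_C dim by simp
  also have "\<dots> = (1 / 2) ^ l * (\<Sum>\<phi>\<in>{0..<l} \<rightarrow>\<^sub>E {0..<n}. \<Prod>i<l. M i (\<phi> i) (\<phi> (Suc i mod l)))"
    unfolding sum_distrib_left[symmetric] using n by (simp add: power_divide)
  also have "(\<Sum>\<phi>\<in>{0..<l} \<rightarrow>\<^sub>E {0..<n}. \<Prod>i<l. M i (\<phi> i) (\<phi> (Suc i mod l)))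
      = (\<Sum>x<n. foldr (\<lambda>i v x. \<Sum>y<n. M i x y * v y) [0..<l] (\<lambda>y. if y = x then 1 else 0) x)"
    using l by (intro closed_walk_sum) simp
  also have "(\<lambda>i v x. \<Sum>y<n. M i x y * v y) = K.X \<circ> edge_sign"
    by (simp add: fun_eq_iff K.X_def K.ip_def K.one_def K.T_def M_def distrib_right sum.distrib
        sum_distrib_left sum_divide_distrib mult.assoc)
  finally show ?thesis by (simp add: K.tr_def foldr_map o_def)
qed

definition err :: real where
  "err = l * (2 ^ l + l + 2)"

lemma density_estimate:
  fixes n A and q \<tau> \<epsilon> :: real
  defines "q \<equiv> skew_kernel.q n (scaled_skew n A)"
    and "\<tau> \<equiv> skew_kernel.tr n (skew_kernel.T n (scaled_skew n A) ^^ l)"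
  assumes A: "weighted_tournament n A" and n: "n \<ge> 1"
    and lam: "lambda_max (skew_part A) \<le> \<epsilon> * n" and \<epsilon>: "\<epsilon> > 0" "4 * \<epsilon> \<le> 1"
  shows "\<bar>2 ^ l * hom_density C A - (1 - q * signed_P3_count l C + (-1) ^ card S * \<tau>)\<bar> \<le> err * (4 * \<epsilon> * q)"
proof -
  interpret K: skew_contraction n "scaled_skew n A" "4 * \<epsilon>"
    by (rule skew_contraction_scaled_skew[OF A n lam \<epsilon>])
  have "2 ^ l * hom_density C A = K.tr (K.XX signs)"
    unfolding hom_density_eq[OF A n] by (simp add: power_divide)
  moreover have "\<bar>s\<bar> = 1" if "s \<in> set signs" for s using that by (auto simp: edge_sign_def)
  ultimately show ?thesis
    using K.tr_XX_estimate[of signs] l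
    by (simp add: signed_P3_count prod_signs err_def q_def \<tau>_def del: upt_Suc)
qed

end

section \<open>The sign of the deviation\<close>

text \<open>Shrinking a fixed kernel by \<open>e\<close> scales \<open>q\<close> by e^2 and the
  trace of the k-th power by e^k. The different rates decide which term dominates in the
  counterexamples.\<close>

lemma perturbation:
  fixes e :: real
  assumes K0: "skew_kernel n K0" and bound: "\<forall>x<n. \<forall>y<n. \<bar>K0 x y\<bar> \<le> 1"
    and e: "0 < e" "e \<le> 1 / 2"
  defines "A \<equiv> mat n n (\<lambda>(x, y). 1 / 2 + e * K0 x y)"
  shows "weighted_tournament n A"
    and "lambda_max (skew_part A) \<le> e * n"
    and "skew_kernel.q n (scaled_skew n A) = (2 * e / n)\<^sup>2 * skew_kernel.q n K0"
    and "skew_kernel.tr n (skew_kernel.T n (scaled_skew n A) ^^ k)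
          = (2 * e / n) ^ k * skew_kernel.tr n (skew_kernel.T n K0 ^^ k)"
proof -
  interpret K0: skew_kernel n K0 by (rule K0)
  have n: "n \<ge> 1" using K0.n_pos by simp
  have small: "\<bar>e * K0 x y\<bar> \<le> e" if "x < n" "y < n" for x y
    using bound that e by (simp add: abs_mult mult_left_le)
  show A: "weighted_tournament n A"
    unfolding weighted_tournament_def
  proof (intro conjI allI impI)
    fix x y assume xy: "x < n" "y < n"
    have "\<bar>e * K0 x y\<bar> \<le> 1 / 2" using small[OF xy] e by linarith
    thus "0 \<le> A $$ (x, y)" "A $$ (x, y) \<le> 1" using xy by (auto simp: A_def)
    have "e * K0 x y = - (e * K0 y x)" using K0.skew[OF xy] by (metis mult_minus_right)
    thus "A $$ (x, y) + A $$ (y, x) = 1" using xy by (simp add: A_def)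
  qed (simp add: A_def)
  show "lambda_max (skew_part A) \<le> e * n"
    by (rule lambda_max_le[OF A n]) (use small in \<open>simp add: A_def\<close>)
  interpret K: skew_kernel n "scaled_skew n A" by (rule skew_kernel_scaled_skew[OF A n])
  have T: "K.T v x = 2 * e / n * K0.T v x" if "x < n" for v x
    using that unfolding K.T_def K0.T_def by (simp add: scaled_skew_def A_def sum_distrib_left mult_ac)
  have pow: "(K.T ^^ k) v x = (2 * e / n) ^ k * (K0.T ^^ k) v x" if "x < n" for k v x
    using that
  proof (induction k arbitrary: x)
    case (Suc k)
    have "K0.T ((K.T ^^ k) v) = K0.T (\<lambda>x. (2 * e / n) ^ k * (K0.T ^^ k) v x)"
      by (rule K0.restrict_sum) (rule Suc.IH)
    thus ?case using Suc.prems by (simp add: T K0.T_scale)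
  qed simp
  show "K.tr (K.T ^^ k) = (2 * e / n) ^ k * K0.tr (K0.T ^^ k)"
    by (simp add: K.tr_def pow sum_distrib_left)
  have "K.d x = 2 * e / n * K0.d x" if "x < n" for x
    unfolding K.d_def K0.d_def by (rule T[OF that])
  hence "(\<Sum>x<n. K.d x * K.d x) = (\<Sum>x<n. (2 * e / n)\<^sup>2 * (K0.d x * K0.d x))"
    by (intro sum.cong) (auto simp: power2_eq_square)
  thus "K.q = (2 * e / n)\<^sup>2 * K0.q"
    by (simp add: K.q_def K0.q_def K.ip_def sum_distrib_left)
qed

section \<open>Two test kernels: a single arc and the cyclic triangle\<close>

lemma skew_kernel_pair: "skew_kernel 2 (\<lambda>x y. real y - real x)"
  by unfold_locales auto

text \<open>The kernel is the single arc from 0 to 1, with row sums 1 and -1.\<close>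

lemma q_pair: "skew_kernel.q 2 (\<lambda>x y. real y - real x) = 1"
proof -
  interpret skew_kernel 2 "\<lambda>x y. real y - real x" by (rule skew_kernel_pair)
  have sum2: "(\<Sum>x<2. f x) = f 0 + f 1" for f :: "nat \<Rightarrow> real"
    by (simp add: numeral_2_eq_2)
  show ?thesis by (simp add: q_def d_def T_def one_def ip_def sum2)
qed

definition cyclic_triangle :: "nat \<Rightarrow> nat \<Rightarrow> real" where
  "cyclic_triangle x y = (if y = Suc x mod 3 then 1 else 0) - (if x = Suc y mod 3 then 1 else 0)"

lemma skew_kernel_triangle: "skew_kernel 3 cyclic_triangle"
  by unfold_locales (auto simp: cyclic_triangle_def)

text \<open>All row sums vanish, and T^2 = J - 3I. Hence T^2 is 0 on constants and -3 on the
  two-dimensional space of vectors with sum 0; m > 0 excludes the identity, whose trace is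
  3.\<close>

lemma triangle_estimates:
  shows q_triangle: "skew_kernel.q 3 cyclic_triangle = 0"
    and tr_triangle: "m > 0 \<Longrightarrow> skew_kernel.tr 3 (skew_kernel.T 3 cyclic_triangle ^^ (2 * m)) = 2 * (-3) ^ m"
proof -
  interpret skew_kernel 3 cyclic_triangle by (rule skew_kernel_triangle)
  have sum3: "(\<Sum>x<3. f x) = f 0 + f 1 + f 2" for f :: "nat \<Rightarrow> real"
    by (simp add: numeral_3_eq_3 numeral_2_eq_2)
  have less3: "x < 3 \<longleftrightarrow> x = 0 \<or> x = 1 \<or> x = 2" for x :: nat by auto
  show "q = 0"
    by (simp add: q_def d_def T_def one_def ip_def sum3 cyclic_triangle_def)
  have TT: "T (T v) x = (v 0 + v 1 + v 2) - 3 * v x" if "x < 3" for v x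
    using that unfolding less3 by (auto simp: T_def sum3 cyclic_triangle_def) (simp add: numeral_2_eq_2)
  have pow: "(T ^^ (2 * Suc j)) v x = (-3) ^ j * ((v 0 + v 1 + v 2) - 3 * v x)" if "x < 3" for j v x
    using that
  proof (induction j arbitrary: x)
    case 0
    have "(T ^^ (2 * Suc 0)) v = T (T v)" by (simp add: numeral_2_eq_2)
    thus ?case using 0 by (simp add: TT)
  next
    case (Suc j)
    define w where "w = (T ^^ (2 * Suc j)) v"
    have w: "w y = (-3) ^ j * ((v 0 + v 1 + v 2) - 3 * v y)" if "y < 3" for y
      unfolding w_def by (rule Suc.IH[OF that])
    have "(T ^^ (2 * Suc (Suc j))) v = T (T w)" by (simp add: w_def)
    thus ?case using Suc.prems by (simp add: TT w algebra_simps)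
  qed
  show "tr (T ^^ (2 * m)) = 2 * (-3) ^ m" if m_pos: "m > 0"
  proof -
    obtain j where m: "m = Suc j" using m_pos by (cases m) auto
    show ?thesis unfolding tr_def m by (simp add: pow sum3 del: mult_Suc_right funpow.simps)
  qed
qed

context oriented_cycle
begin

section \<open>Sign criteria for LTS and LTAS\<close>

lemma err_nonneg: "err \<ge> 0"
  by (simp add: err_def)

lemma perturbed_density:
  fixes e :: real
  assumes K0: "skew_kernel n K0" and bound: "\<forall>x<n. \<forall>y<n. \<bar>K0 x y\<bar> \<le> 1"
    and e: "0 < e" "4 * e \<le> 1"
  obtains A where "weighted_tournament n A" "lambda_max (skew_part A) \<le> e * n"
    "\<bar>2 ^ l * hom_density C A - (1 - (2 * e / n)\<^sup>2 * skew_kernel.q n K0 * signed_P3_count l C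
        + (-1) ^ card S * ((2 * e / n) ^ l * skew_kernel.tr n (skew_kernel.T n K0 ^^ l)))\<bar>
      \<le> err * (4 * e * ((2 * e / n)\<^sup>2 * skew_kernel.q n K0))"
proof -
  have n: "n \<ge> 1" using K0 by (simp add: skew_kernel_def)
  have e2: "e \<le> 1 / 2" using e by simp
  note A = perturbation[OF K0 bound e(1) e2]
  show ?thesis
    using that[OF A(1,2)] density_estimate[OF A(1) n A(2) e] unfolding A(3,4) by blast
qed

lemma trace_sign:
  assumes "skew_kernel n K"
  defines "\<tau> \<equiv> skew_kernel.tr n (skew_kernel.T n K ^^ l)"
  shows "odd l \<Longrightarrow> \<tau> = 0" and "even l \<Longrightarrow> (-1) ^ (l div 2) * \<tau> \<ge> 0"
proof -
  interpret skew_kernel n K by fact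
  show "\<tau> = 0" if "odd l" using tr_T_power_odd[OF that] by (simp add: \<tau>_def)
  show "(-1) ^ (l div 2) * \<tau> \<ge> 0" if "even l"
    using tr_T_power_even[of "l div 2"] that by (simp add: \<tau>_def)
qed

text \<open>For even \<open>l\<close> this is the sign with which |\<open>\<tau>\<close>| enters the
  density. The parity conditions of the theorem say that it is 1 or -1.\<close>

definition \<sigma> :: real where
  "\<sigma> = (-1) ^ card S * (-1) ^ (l div 2)"

lemma \<sigma>_cases: "\<sigma> = 1 \<or> \<sigma> = -1"
  by (cases "even (card S)"; cases "even (l div 2)") (auto simp: \<sigma>_def)

lemma trace_term: "(-1) ^ card S * \<tau> = \<sigma> * ((-1) ^ (l div 2) * \<tau>)"
  by (simp add: \<sigma>_def flip: mult.assoc power_mult_distrib)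

text \<open>The radius 1 / (4 (\<open>err\<close> + 1)) turns the error of
  \<open>density_estimate\<close> into \<open>err\<close> / (\<open>err\<close> + 1) times
  \<open>q\<close>, which is at most \<open>q\<close>.\<close>

lemma local_estimate:
  fixes n A
  defines "q \<equiv> skew_kernel.q n (scaled_skew n A)"
    and "\<tau> \<equiv> skew_kernel.tr n (skew_kernel.T n (scaled_skew n A) ^^ l)"
  assumes A: "weighted_tournament n A" and n: "n \<ge> 1"
    and lam: "lambda_max (skew_part A) \<le> 1 / (4 * (err + 1)) * n"
  shows "\<bar>2 ^ l * hom_density C A - (1 - q * signed_P3_count l C + (-1) ^ card S * \<tau>)\<bar> \<le> q"
    and "q \<ge> 0" and "odd l \<Longrightarrow> \<tau> = 0" and "even l \<Longrightarrow> (-1) ^ (l div 2) * \<tau> \<ge> 0"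
proof -
  note K = skew_kernel_scaled_skew[OF A n]
  show q: "q \<ge> 0" unfolding q_def by (rule skew_kernel.q_nonneg[OF K])
  show "\<tau> = 0" if "odd l" unfolding \<tau>_def by (rule trace_sign(1)[OF K that])
  show "(-1) ^ (l div 2) * \<tau> \<ge> 0" if "even l" unfolding \<tau>_def by (rule trace_sign(2)[OF K that])
  have "4 * (1 / (4 * (err + 1))) = 1 / (err + 1)" using err_nonneg by (simp add: field_simps)
  hence "err * (4 * (1 / (4 * (err + 1))) * q) = err / (err + 1) * q" by (simp only:) simp
  also have "\<dots> \<le> 1 * q" using q err_nonneg by (intro mult_right_mono) auto
  finally have "err * (4 * (1 / (4 * (err + 1))) * q) \<le> q" by simp
  moreover have "1 / (4 * (err + 1)) > 0" "4 * (1 / (4 * (err + 1))) \<le> 1"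
    using err_nonneg by (simp_all add: field_simps)
  ultimately show "\<bar>2 ^ l * hom_density C A - (1 - q * signed_P3_count l C + (-1) ^ card S * \<tau>)\<bar> \<le> q"
    using density_estimate[OF A n lam] unfolding q_def \<tau>_def by linarith
qed

text \<open>The count is an integer, hence at most -1, so its term gains at least \<open>q\<close>
  and pays for the error, while the trace term is nonnegative. \<open>LTAS_criterion\<close> is the
  mirror image.\<close>

lemma LTS_criterion:
  assumes "signed_P3_count l C < 0" and "odd l \<or> \<sigma> = 1"
  shows "LTS C"
  unfolding LTS_def card_parcs
proof (intro exI[of _ "1 / (4 * (err + 1))"] conjI allI impI)
  show "0 < 1 / (4 * (err + 1))" using err_nonneg by simp
  fix n A assume "n \<ge> (1::nat)" "weighted_tournament n A \<and> lambda_max (skew_part A) \<le> 1 / (4 * (err + 1)) * n"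
  define q where "q = skew_kernel.q n (scaled_skew n A)"
  define \<tau> where "\<tau> = skew_kernel.tr n (skew_kernel.T n (scaled_skew n A) ^^ l)"
  have est: "\<bar>2 ^ l * hom_density C A - (1 - q * signed_P3_count l C + (-1) ^ card S * \<tau>)\<bar> \<le> q"
    and q: "q \<ge> 0" and \<tau>: "odd l \<Longrightarrow> \<tau> = 0" "even l \<Longrightarrow> (-1) ^ (l div 2) * \<tau> \<ge> 0"
    using local_estimate[of n A] \<open>n \<ge> 1\<close> \<open>weighted_tournament n A \<and> _\<close> unfolding q_def \<tau>_def by blast+
  have "(-1) ^ card S * \<tau> \<ge> 0" unfolding trace_term using \<tau> assms(2) by fastforce
  moreover have "q * real_of_int (signed_P3_count l C) \<le> q * (-1)"
    using assms(1) q by (intro mult_left_mono) auto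
  ultimately have "2 ^ l * hom_density C A \<ge> 1" using est by linarith
  thus "(1 / 2) ^ l \<le> hom_density C A" by (simp add: power_divide field_simps)
qed

lemma LTAS_criterion:
  assumes "signed_P3_count l C > 0" and "odd l \<or> \<sigma> = -1"
  shows "LTAS C"
  unfolding LTAS_def card_parcs
proof (intro exI[of _ "1 / (4 * (err + 1))"] conjI allI impI)
  show "0 < 1 / (4 * (err + 1))" using err_nonneg by simp
  fix n A assume "n \<ge> (1::nat)" "weighted_tournament n A \<and> lambda_max (skew_part A) \<le> 1 / (4 * (err + 1)) * n"
  define q where "q = skew_kernel.q n (scaled_skew n A)"
  define \<tau> where "\<tau> = skew_kernel.tr n (skew_kernel.T n (scaled_skew n A) ^^ l)"
  have est: "\<bar>2 ^ l * hom_density C A - (1 - q * signed_P3_count l C + (-1) ^ card S * \<tau>)\<bar> \<le> q"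
    and q: "q \<ge> 0" and \<tau>: "odd l \<Longrightarrow> \<tau> = 0" "even l \<Longrightarrow> (-1) ^ (l div 2) * \<tau> \<ge> 0"
    using local_estimate[of n A] \<open>n \<ge> 1\<close> \<open>weighted_tournament n A \<and> _\<close> unfolding q_def \<tau>_def by blast+
  have "(-1) ^ card S * \<tau> \<le> 0" unfolding trace_term using \<tau> assms(2) by fastforce
  moreover have "q * real_of_int (signed_P3_count l C) \<ge> q * 1"
    using assms(1) q by (intro mult_left_mono) auto
  ultimately have "2 ^ l * hom_density C A \<le> 1" using est by linarith
  thus "(1 / 2) ^ l \<ge> hom_density C A" by (simp add: power_divide field_simps)
qed

text \<open>The cyclic triangle is regular, so only the trace term survives.\<close>

lemma trace_dominated:
  fixes \<epsilon> :: real
  assumes "even l" and \<epsilon>: "\<epsilon> > 0"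
  obtains n A where "n \<ge> 1" "weighted_tournament n A" "lambda_max (skew_part A) \<le> \<epsilon> * n"
    "\<sigma> * (2 ^ l * hom_density C A - 1) > 0"
proof -
  define e where "e = min \<epsilon> (1 / 4)"
  have e: "0 < e" "4 * e \<le> 1" "e \<le> \<epsilon>" using \<epsilon> by (auto simp: e_def)
  have bound: "\<forall>x<3. \<forall>y<3. \<bar>cyclic_triangle x y\<bar> \<le> 1" by (simp add: cyclic_triangle_def)
  obtain m where m: "l = 2 * m" "m > 0" using \<open>even l\<close> l by (elim evenE) auto
  obtain A where A: "weighted_tournament 3 A" "lambda_max (skew_part A) \<le> e * real 3"
    and est: "2 ^ l * hom_density C A = 1 + (-1) ^ card S * ((2 * e / 3) ^ l * (2 * (-3) ^ m))"
    using perturbed_density[OF skew_kernel_triangle bound e(1,2)] tr_triangle[OF m(2)]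
    by (auto simp: q_triangle m(1)[symmetric])
  have "(2 * e / 3) ^ l * (2 * (-3) ^ m) = (-1) ^ (l div 2) * ((2 * e / 3) ^ l * (2 * 3 ^ m))"
    by (simp add: m power_minus[of 3])
  hence "2 ^ l * hom_density C A - 1 = \<sigma> * ((2 * e / 3) ^ l * (2 * 3 ^ m))"
    unfolding est \<sigma>_def by simp
  hence "\<sigma> * (2 ^ l * hom_density C A - 1) = (2 * e / 3) ^ l * (2 * 3 ^ m)"
    using \<sigma>_cases by auto
  also have "\<dots> > 0" using e by simp
  finally have "\<sigma> * (2 ^ l * hom_density C A - 1) > 0" .
  moreover have "lambda_max (skew_part A) \<le> \<epsilon> * real 3" using A(2) e(3) by simp
  ultimately show ?thesis using that[of 3 A] A(1) by simp
qed

text \<open>For the single arc the count term is -e^2 c, whereas the trace term is O(e^l) with l >=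
  4 and the error is O(e^3). For small \<open>e\<close> the deviation thus has the sign opposite to
  the count.\<close>

lemma count_dominated:
  fixes \<epsilon> :: real
  assumes "even l" and \<epsilon>: "\<epsilon> > 0" and cnt: "signed_P3_count l C \<noteq> 0"
  obtains n A where "n \<ge> 1" "weighted_tournament n A" "lambda_max (skew_part A) \<le> \<epsilon> * n"
    "real_of_int (signed_P3_count l C) * (2 ^ l * hom_density C A - 1) < 0"
proof -
  let ?K = "\<lambda>x y. real y - real x"
  define c where "c = real_of_int (signed_P3_count l C)"
  define \<tau> where "\<tau> = skew_kernel.tr 2 (skew_kernel.T 2 ?K ^^ l)"
  \<comment> \<open>\<open>D\<close> collects the coefficients of e^3 from trace and error. The
    additional 4 in the bound on \<open>e\<close> yields both 4e <= 1 and the strict e D <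
    1.\<close>
  define D where "D = \<bar>\<tau>\<bar> + 4 * err"
  define e where "e = min \<epsilon> (1 / (D + 4))"
  have D: "D \<ge> 0" using err_nonneg by (simp add: D_def)
  have e: "0 < e" "e \<le> \<epsilon>" "e \<le> 1 / (D + 4)" using \<epsilon> D by (auto simp: e_def)
  have eD: "e * D + 4 * e \<le> 1" using e(3) D by (simp add: field_simps)
  have e4: "4 * e \<le> 1" using eD mult_nonneg_nonneg[of e D] e D by linarith
  have l4: "l \<ge> 4" using l \<open>even l\<close> by (cases "l = 3") auto
  have c1: "\<bar>c\<bar> \<ge> 1" using cnt unfolding c_def by linarith
  have bound: "\<forall>x<2. \<forall>y<2. \<bar>?K x y\<bar> \<le> 1" by auto
  obtain A where A: "weighted_tournament 2 A" "lambda_max (skew_part A) \<le> e * real 2"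
    and est: "\<bar>2 ^ l * hom_density C A - (1 - e\<^sup>2 * c + (-1) ^ card S * (e ^ l * \<tau>))\<bar> \<le> err * (4 * e * e\<^sup>2)"
    using perturbed_density[OF skew_kernel_pair bound e(1) e4]
    by (auto simp: q_pair c_def \<tau>_def)
  have "e ^ l \<le> e ^ 3" using l4 e e4 by (intro power_decreasing) auto
  hence "e ^ l * \<bar>\<tau>\<bar> \<le> e ^ 3 * \<bar>\<tau>\<bar>" by (intro mult_right_mono) auto
  hence "\<bar>(-1) ^ card S * (e ^ l * \<tau>)\<bar> \<le> e ^ 3 * \<bar>\<tau>\<bar>" using e by (simp add: abs_mult)
  hence "\<bar>2 ^ l * hom_density C A - 1 + e\<^sup>2 * c\<bar> \<le> e ^ 3 * \<bar>\<tau>\<bar> + err * (4 * e * e\<^sup>2)"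
    using est by linarith
  also have "\<dots> = e\<^sup>2 * (e * D)" by (simp add: D_def power2_eq_square power3_eq_cube algebra_simps)
  also have "\<dots> < e\<^sup>2 * 1" using eD e by (intro mult_strict_left_mono) auto
  finally have *: "\<bar>2 ^ l * hom_density C A - 1 + e\<^sup>2 * c\<bar> < e\<^sup>2" by simp
  have "c * (2 ^ l * hom_density C A - 1) < 0"
  proof (cases "c > 0")
    case True
    hence "e\<^sup>2 * c \<ge> e\<^sup>2 * 1" using c1 by (intro mult_left_mono) auto
    hence "2 ^ l * hom_density C A - 1 < 0" using * by linarith
    thus ?thesis using True by (simp add: mult_pos_neg)
  next
    case False
    hence "e\<^sup>2 * c \<le> e\<^sup>2 * (-1)" using c1 by (intro mult_left_mono) auto
    hence "2 ^ l * hom_density C A - 1 > 0" using * by linarith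
    thus ?thesis using False c1 by (intro mult_neg_pos) auto
  qed
  moreover have "lambda_max (skew_part A) \<le> \<epsilon> * real 2" using A(2) e(2) by simp
  ultimately show ?thesis using that[of 2 A] A(1) by (simp add: c_def)
qed

lemma not_LTS:
  assumes "\<And>\<epsilon>::real. \<epsilon> > 0 \<Longrightarrow> \<exists>n A. n \<ge> 1 \<and> weighted_tournament n A \<and>
      lambda_max (skew_part A) \<le> \<epsilon> * n \<and> 2 ^ l * hom_density C A < 1"
  shows "\<not> LTS C"
proof
  assume "LTS C"
  then obtain \<epsilon> where \<epsilon>: "\<epsilon> > 0" and *: "\<And>n A. n \<ge> 1 \<Longrightarrow> weighted_tournament n A \<Longrightarrow>
      lambda_max (skew_part A) \<le> \<epsilon> * real n \<Longrightarrow> hom_density C A \<ge> (1/2) ^ l"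
    unfolding LTS_def card_parcs by blast
  obtain n A where "n \<ge> 1" "weighted_tournament n A" "lambda_max (skew_part A) \<le> \<epsilon> * real n"
    and small: "2 ^ l * hom_density C A < 1"
    using assms[OF \<epsilon>] by blast
  hence "hom_density C A \<ge> (1/2) ^ l" by (intro *)
  thus False using small by (simp add: power_divide field_simps)
qed

lemma not_LTAS:
  assumes "\<And>\<epsilon>::real. \<epsilon> > 0 \<Longrightarrow> \<exists>n A. n \<ge> 1 \<and> weighted_tournament n A \<and>
      lambda_max (skew_part A) \<le> \<epsilon> * n \<and> 2 ^ l * hom_density C A > 1"
  shows "\<not> LTAS C"
proof
  assume "LTAS C"
  then obtain \<epsilon> where \<epsilon>: "\<epsilon> > 0" and *: "\<And>n A. n \<ge> 1 \<Longrightarrow> weighted_tournament n A \<Longrightarrow>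
      lambda_max (skew_part A) \<le> \<epsilon> * real n \<Longrightarrow> hom_density C A \<le> (1/2) ^ l"
    unfolding LTAS_def card_parcs by blast
  obtain n A where "n \<ge> 1" "weighted_tournament n A" "lambda_max (skew_part A) \<le> \<epsilon> * real n"
    and large: "2 ^ l * hom_density C A > 1"
    using assms[OF \<epsilon>] by blast
  hence "hom_density C A \<le> (1/2) ^ l" by (intro *)
  thus False using large by (simp add: power_divide field_simps)
qed

text \<open>The triangle deviates with the sign \<open>\<sigma>\<close>, the single arc with the
  sign opposite to the count. Under \<open>opp\<close> these differ, so arbitrarily close to 1/2
  there are densities on both sides of 2^(-l).\<close>

lemma neither_criterion:
  assumes "even l" and opp: "signed_P3_count l C < 0 \<and> \<sigma> = -1 \<or> signed_P3_count l C > 0 \<and> \<sigma> = 1"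
  shows "\<not> LTS C \<and> \<not> LTAS C"
proof -
  let ?ex = "\<lambda>\<epsilon> P. \<exists>n A. n \<ge> 1 \<and> weighted_tournament n A \<and>
      lambda_max (skew_part A) \<le> \<epsilon> * real n \<and> P (2 ^ l * hom_density C A)"
  have 1: "?ex \<epsilon> (\<lambda>h. \<sigma> * (h - 1) > 0)" if "\<epsilon> > 0" for \<epsilon> :: real
    using trace_dominated[OF \<open>even l\<close> that] by metis
  have 2: "?ex \<epsilon> (\<lambda>h. real_of_int (signed_P3_count l C) * (h - 1) < 0)" if "\<epsilon> > 0" for \<epsilon> :: real
    using count_dominated[OF \<open>even l\<close> that] opp by (metis less_irrefl)
  from opp show ?thesis
  proof
    assume *: "signed_P3_count l C < 0 \<and> \<sigma> = -1"
    hence "\<sigma> * (h - 1) > 0 \<longleftrightarrow> h < 1" "real_of_int (signed_P3_count l C) * (h - 1) < 0 \<longleftrightarrow> h > 1" for h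
      by (auto simp: mult_less_0_iff)
    thus ?thesis using 1 2 by (intro conjI not_LTS not_LTAS) simp_all
  next
    assume *: "signed_P3_count l C > 0 \<and> \<sigma> = 1"
    hence "\<sigma> * (h - 1) > 0 \<longleftrightarrow> h > 1" "real_of_int (signed_P3_count l C) * (h - 1) < 0 \<longleftrightarrow> h < 1" for h
      by (auto simp: mult_less_0_iff)
    thus ?thesis using 1 2 by (intro conjI not_LTS not_LTAS) simp_all
  qed
qed

lemma \<sigma>_eq_1_iff:
  assumes "even l"
  shows "\<sigma> = 1 \<longleftrightarrow> (l mod 4 = 0 \<and> even (card S)) \<or> (l mod 4 = 2 \<and> odd (card S))"
proof -
  have "even (l div 2) \<longleftrightarrow> l mod 4 = 0" "odd (l div 2) \<longleftrightarrow> l mod 4 = 2" using assms by presburger+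
  thus ?thesis by (cases "even (card S)"; cases "even (l div 2)") (auto simp: \<sigma>_def)
qed

lemma \<sigma>_eq_minus_1_iff:
  assumes "even l"
  shows "\<sigma> = -1 \<longleftrightarrow> (l mod 4 = 0 \<and> odd (card S)) \<or> (l mod 4 = 2 \<and> even (card S))"
proof -
  have "even (l div 2) \<longleftrightarrow> l mod 4 = 0" "odd (l div 2) \<longleftrightarrow> l mod 4 = 2" using assms by presburger+
  thus ?thesis by (cases "even (card S)"; cases "even (l div 2)") (auto simp: \<sigma>_def)
qed

end

theorem theorem3p17:
  fixes l t :: nat and S :: "nat rel" and C :: "nat pair_pre_digraph"
  assumes "3 \<le> l" and "t \<le> l"
    and "S \<subseteq> parcs (directed_cycle l)" and "card S = t"
    and "C = reverse_arcs S (directed_cycle l)"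
    and "signed_P3_count l C \<noteq> 0"
  defines "hyp_i \<equiv> signed_P3_count l C < 0 \<and>
      (odd l \<or> (l mod 4 = 0 \<and> even t) \<or> (l mod 4 = 2 \<and> odd t))"
    and "hyp_ii \<equiv> signed_P3_count l C > 0 \<and>
      (odd l \<or> (l mod 4 = 0 \<and> odd t) \<or> (l mod 4 = 2 \<and> even t))"
  shows "(hyp_i \<longrightarrow> LTS C) \<and>
    (hyp_ii \<longrightarrow> LTAS C) \<and>
    (\<not> hyp_i \<and> \<not> hyp_ii \<longrightarrow> \<not> LTS C \<and> \<not> LTAS C)"
proof -
  interpret oriented_cycle l S C
    by unfold_locales (use assms in auto)
  have i: "hyp_i \<longleftrightarrow> signed_P3_count l C < 0 \<and> (odd l \<or> \<sigma> = 1)"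
    using \<sigma>_eq_1_iff \<open>card S = t\<close> by (cases "even l") (auto simp: hyp_i_def)
  have ii: "hyp_ii \<longleftrightarrow> signed_P3_count l C > 0 \<and> (odd l \<or> \<sigma> = -1)"
    using \<sigma>_eq_minus_1_iff \<open>card S = t\<close> by (cases "even l") (auto simp: hyp_ii_def)
  show ?thesis
  proof (intro conjI impI)
    show "LTS C" if hyp_i using that LTS_criterion unfolding i by blast
    show "LTAS C" if hyp_ii using that LTAS_criterion unfolding ii by blast
    assume "\<not> hyp_i \<and> \<not> hyp_ii"
    \<comment> \<open>For odd \<open>l\<close> a nonzero count would satisfy one of the two
      hypotheses. For even \<open>l\<close> their failure excludes the value of
      \<open>\<sigma>\<close> that fits the sign of the count.\<close>
    hence "even l" "signed_P3_count l C < 0 \<and> \<sigma> = -1 \<or> signed_P3_count l C > 0 \<and> \<sigma> = 1"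
      using \<open>signed_P3_count l C \<noteq> 0\<close> \<sigma>_cases unfolding i ii by (meson linorder_neqE)+
    thus "\<not> LTS C" "\<not> LTAS C" using neither_criterion by blast+
  qed
qed

end
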